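(* Let $A=\bigcup_{k=1}^NA_k\subset\mathbb{R}^2$ be an $N$-layer concentric disk with (known) radii $r_1>\cdots>r_N>0$, and let $(\sigma_k^{(1)})_{k=1}^N$ and $(\sigma_k^{(2)})_{k=1}^N$ be two sets of layer conductivities (see context). Let $M>N$ be an integer, let $(i_1,\dots,i_N)$ be integers with $1\le i_1<i_2<\cdots<i_N\le M$, and let $H$ be the partial-order background electrical potential $$H=\sum_{k=1}^Na_{i_k}r^{i_k}e^{\mathrm{i}\,i_k\theta}$$ in polar coordinates $(r,\theta)$, where the $a_{i_k}$ are constants. For $j=1,2$ let $u_j$ be the solution of $$\nabla\cdot(\sigma^{(j)}\nabla u_j)=0\ \text{ in }\mathbb{R}^2,\qquad u_j-H=\mathcal{O}(|x|^{-1})\ \text{ as }|x|\to\infty,$$ where $\sigma^{(j)}=\sigma_k^{(j)}$ in $A_k$, $k=0,\dots,N$, with $\sigma_0^{(j)}=1$. Suppose that $H$ (that is, the choice of orders $i_1,\dots,i_N$) is such that the $N\times N$ matrix $\mathbb{T}_N$ with entries $$(\mathbb{T}_N)_{kl}=(\mathbb{L}_{N,1})_{kl}\,(\mathbb{R}_{N,2})_{lk},\quad k,l=1,\dots,N,$$ is invertible, where $\mathbb{L}_{N,1}$ is the $N\times N$ matrix whose $k$-th row is $\bm{e}^T\Upsilon_N^{(i_k)}(\mathbb{M}_{N,1}^{(i_k)})^*$ and $\mathbb{R}_{N,2}$ is the $N\times N$ matrix whose $k$-th column is $(\mathbb{M}_{N,2}^{(i_k)})^*\bm{e}$. Let $\Omega$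 be a bounded domain enclosing $A$, i.e. $A\subset\Omega$, and let $\Pi$ be an open subset of $\partial\Omega$. If $u_1=u_2$ on $\Pi$, then $$\sigma_k^{(1)}=\sigma_k^{(2)},\qquad k=1,2,\dots,N.$$
   Context: $N$-layer concentric disk: $A_0=\{|x|>r_1\}$, $A_k=\{r_{k+1}<|x|\le r_k\}$ for $k=1,\dots,N-1$, and $A_N=\{|x|\le r_N\}$. The conductivities $\sigma_k^{(j)}$ are positive constants with $\sigma_0^{(j)}=1$ and $\sigma_k^{(j)}\neq\sigma_{k-1}^{(j)}$, and $$\lambda_k^{(j)}=\frac{\sigma_k^{(j)}+\sigma_{k-1}^{(j)}}{2(\sigma_k^{(j)}-\sigma_{k-1}^{(j)})},\quad k=1,\dots,N,\ j=1,2.$$ The equation for $u_j$ includes the transmission conditions that $u_j$ and the flux $\sigma^{(j)}\partial u_j/\partial\nu$ are continuous across every interface $\{|x|=r_k\}$. Functions may be complex-valued. A harmonic function $H(x)=H(0)+\sum_{n\ge1}r^n(a_n^c\cos n\theta+a_n^s\sin n\theta)$ on $\mathbb{R}^2$ is called of full order if $a_n^c\neq0$ and $a_n^s\neq0$ for all $n\ge1$, and of partial order otherwise. For $n\ge1$ and $j=1,2$, $\mathbb{M}^{(n)}_{N,j}$ is the $N\times N$ matrix (the $n$-order generalized polarization matrix) with entries $-2\lambda^{(j)}_p$ at position $(p,p)$, $(r_q/r_p)^{2n}$ at position $(p,q)$ for $p<q$, and $-1$ at position $(p,q)$ for $p>q$. $\Upsilon_N^{(n)}=\mathrm{diag}(r_1^{2n},\dots,r_N^{2n})$,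 $\bm{e}=(1,\dots,1)^T\in\mathbb{R}^N$, and the superscript $*$ denotes the adjugate of a matrix.
   Formalization: The formal theorem also assumes that all constants a_{i_k} are nonzero and that Π is infinite (automatic for nonempty Π if ∂Ω has no isolated points); with H = 0 or Π empty the claim as stated is false. *)

theory Defs
  imports
    "HOL-Analysis.Analysis"
    "HOL-Library.Landau_Symbols"
    "Jordan_Normal_Form.Determinant"
begin

(* The plane R^2 is the type complex regarded as a two-dimensional real normed space.  All
   derivatives are real (Frechet) derivatives; the partial derivatives are those in the
   directions 1 and \<i>.  The families r_k, sigma_k, i_k are functions on nat, of which only the
   values at 1,...,N (0,...,N for sigma) matter. *)

definition layer :: "nat \<Rightarrow> (nat \<Rightarrow> real) \<Rightarrow> nat \<Rightarrow> complex set" where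
  "layer N r k =
     (if k = 0 then {x. norm x > r 1}
      else if k < N then {x. r (k + 1) < norm x \<and> norm x \<le> r k}
      else {x. norm x \<le> r N})"

definition conductivity :: "nat \<Rightarrow> (nat \<Rightarrow> real) \<Rightarrow> (nat \<Rightarrow> real) \<Rightarrow> complex \<Rightarrow> real" where
  "conductivity N r \<sigma> x = (\<Sum>k=0..N. \<sigma> k * indicat_real (layer N r k) x)"

definition dir_deriv :: "complex \<Rightarrow> (complex \<Rightarrow> complex) \<Rightarrow> complex \<Rightarrow> complex" where
  "dir_deriv v f x = frechet_derivative f (at x) v"

definition C1_on :: "complex set \<Rightarrow> (complex \<Rightarrow> complex) \<Rightarrow> bool" where
  "C1_on S f \<longleftrightarrow>
     (\<forall>x\<in>S. f differentiable (at x)) \<and>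
     continuous_on S (dir_deriv 1 f) \<and> continuous_on S (dir_deriv \<i> f)"

definition C2_on :: "complex set \<Rightarrow> (complex \<Rightarrow> complex) \<Rightarrow> bool" where
  "C2_on S f \<longleftrightarrow> C1_on S f \<and> C1_on S (dir_deriv 1 f) \<and> C1_on S (dir_deriv \<i> f)"

(* The divergence of s grad f. *)
definition div_grad :: "(complex \<Rightarrow> real) \<Rightarrow> (complex \<Rightarrow> complex) \<Rightarrow> complex \<Rightarrow> complex" where
  "div_grad s f x =
     dir_deriv 1 (\<lambda>y. s y *\<^sub>R dir_deriv 1 f y) x +
     dir_deriv \<i> (\<lambda>y. s y *\<^sub>R dir_deriv \<i> f y) x"

(* The outward unit normal of the circle through y centred at 0 is sgn y = y / |y|. *)
definition flux :: "(complex \<Rightarrow> real) \<Rightarrow> (complex \<Rightarrow> complex) \<Rightarrow> complex \<Rightarrow> complex" where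
  "flux s f y = s y *\<^sub>R dir_deriv (sgn y) f y"

(* Solution of div (sigma grad u) = 0 in R^2 with u - H = O(1/|x|), in the classical transmission
   sense: the equation holds inside every layer, u is continuous, and at every interface point
   the flux has limits from inside and from outside, which agree. *)
definition conductivity_solution ::
  "nat \<Rightarrow> (nat \<Rightarrow> real) \<Rightarrow> (nat \<Rightarrow> real) \<Rightarrow> (complex \<Rightarrow> complex) \<Rightarrow> (complex \<Rightarrow> complex) \<Rightarrow> bool" where
  "conductivity_solution N r \<sigma> H u \<longleftrightarrow>
     (\<forall>k\<le>N. C2_on (interior (layer N r k)) u \<and>
        (\<forall>x\<in>interior (layer N r k). div_grad (conductivity N r \<sigma>) u x = 0)) \<and>
     continuous_on UNIV u \<and>
     (\<forall>k\<in>{1..N}. \<forall>x\<in>sphere 0 (r k). \<exists>g.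
        (flux (conductivity N r \<sigma>) u \<longlongrightarrow> g) (at x within interior (layer N r k)) \<and>
        (flux (conductivity N r \<sigma>) u \<longlongrightarrow> g) (at x within interior (layer N r (k - 1)))) \<and>
     (\<lambda>x. norm (u x - H x)) \<in> O[at_infinity](\<lambda>x. 1 / norm x)"

(* norm x and Arg x are the polar coordinates of x. *)
definition background :: "nat \<Rightarrow> (nat \<Rightarrow> nat) \<Rightarrow> (nat \<Rightarrow> complex) \<Rightarrow> complex \<Rightarrow> complex" where
  "background N i a x =
     (\<Sum>k=1..N. a (i k) * complex_of_real (norm x ^ i k) *
        exp (\<i> * complex_of_real (real (i k) * Arg x)))"

definition contrast :: "(nat \<Rightarrow> real) \<Rightarrow> nat \<Rightarrow> real" where
  "contrast \<sigma> k = (\<sigma> k + \<sigma> (k - 1)) / (2 * (\<sigma> k - \<sigma> (k - 1)))"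

(* Library matrices are indexed from 0: entry (p, q) below is the one at position (p+1, q+1). *)
definition gpm :: "nat \<Rightarrow> (nat \<Rightarrow> real) \<Rightarrow> (nat \<Rightarrow> real) \<Rightarrow> nat \<Rightarrow> real mat" where
  "gpm N r \<sigma> n = Matrix.mat N N (\<lambda>(p, q).
     if p = q then - 2 * contrast \<sigma> (p + 1)
     else if p < q then (r (q + 1) / r (p + 1)) ^ (2 * n)
     else - 1)"

definition Upsilon :: "nat \<Rightarrow> (nat \<Rightarrow> real) \<Rightarrow> nat \<Rightarrow> real mat" where
  "Upsilon N r n = mat_diag N (\<lambda>p. r (p + 1) ^ (2 * n))"

(* The vector e as an N x 1 matrix. *)
definition ones :: "nat \<Rightarrow> real mat" where
  "ones N = Matrix.mat N 1 (\<lambda>_. 1)"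

definition L_mat :: "nat \<Rightarrow> (nat \<Rightarrow> real) \<Rightarrow> (nat \<Rightarrow> real) \<Rightarrow> (nat \<Rightarrow> nat) \<Rightarrow> real mat" where
  "L_mat N r \<sigma> i = mat_of_rows N
     (map (\<lambda>k. Matrix.row (transpose_mat (ones N) * Upsilon N r (i k) * adj_mat (gpm N r \<sigma> (i k))) 0)
       [1..<N + 1])"

definition R_mat :: "nat \<Rightarrow> (nat \<Rightarrow> real) \<Rightarrow> (nat \<Rightarrow> real) \<Rightarrow> (nat \<Rightarrow> nat) \<Rightarrow> real mat" where
  "R_mat N r \<sigma> i = mat_of_cols N
     (map (\<lambda>k. Matrix.col (adj_mat (gpm N r \<sigma> (i k)) * ones N) 0) [1..<N + 1])"

definition T_mat ::
  "nat \<Rightarrow> (nat \<Rightarrow> real) \<Rightarrow> (nat \<Rightarrow> real) \<Rightarrow> (nat \<Rightarrow> real) \<Rightarrow> (nat \<Rightarrow> nat) \<Rightarrow> real mat" where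
  "T_mat N r \<sigma>1 \<sigma>2 i =
     Matrix.mat N N (\<lambda>(k, l). L_mat N r \<sigma>1 i $$ (k, l) * R_mat N r \<sigma>2 i $$ (l, k))"

end

(* On each circle |x| = \<rho> take the m-th Fourier coefficient of a solution u, n = |m|.  In the k-th layer it
   equals \<alpha>_k \<rho>^n + \<beta>_k / \<rho>^n; the transmission conditions at the interfaces say that the jumps
   d_k = \<alpha>_k - \<alpha>_(k-1) solve M d = h e, where h comes from H and M is the polarization matrix, and the
   exterior coefficient is \<beta>_0 = e^T \<Upsilon> d.  Modes absent from H vanish outside the disk, so u_1 - u_2 is
   there a polynomial in 1 / cnj z.  It vanishes on an infinite set, hence identically, which gives
   e^T \<Upsilon> d^(1) = e^T \<Upsilon> d^(2) at every order i_k.  Since M_1 and M_2 differ only on the diagonal, the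
   resolvent identity for adjugates turns this into T (\<lambda>^(1) - \<lambda>^(2)) = 0. *)

theory Submission
  imports Defs
begin

section \<open>Directional derivatives and mixed partials\<close>

text \<open>The radial formula is reached through first-order identities. For harmonic u the
  function u_x - i u_y is holomorphic, so Cauchy's theorem on concentric circles makes one
  combination of the m-th coefficient and its radial derivative a pure power of the radius; the
  conjugate of u supplies a second combination.

  The two fields are compared only on a boundary piece of arbitrary shape, and a general harmonic
  function can vanish along a whole curve. What rescues the argument is that H is a sum of powers
  z^n: the decaying harmonic function of the same frequency is 1 / cnj z^n, so the difference is a
  polynomial in a single complex variable and has finitely many zeros unless it is zero.

  The exterior field at one order yields one equation, while N contrasts are unknown; the N orders
  i_k supply N equations, linear in the differences of the contrasts although their coefficients
  involve both conductivities. Equal contrasts give equal conductivities layer by layer, starting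
  from sigma_0 = 1.\<close>

lemma dir_deriv_eq:
  assumes "u differentiable (at z)"
  shows "dir_deriv v u z = Re v *\<^sub>R dir_deriv 1 u z + Im v *\<^sub>R dir_deriv \<i> u z"
proof -
  interpret bounded_linear "frechet_derivative u (at z)"
    using assms by (simp add: frechet_derivative_works has_derivative_bounded_linear)
  have "v = Re v *\<^sub>R 1 + Im v *\<^sub>R \<i>"
    by (simp add: complex_eq_iff)
  then have "frechet_derivative u (at z) v = frechet_derivative u (at z) (Re v *\<^sub>R 1 + Im v *\<^sub>R \<i>)"
    by simp
  then show ?thesis
    by (simp only: dir_deriv_def add scaleR)
qed

lemma has_vector_derivative_dir_deriv:
  assumes "u differentiable (at (p t))" and "(p has_vector_derivative v) (at t within T)"
  shows "((\<lambda>t. u (p t)) has_vector_derivative dir_deriv v u (p t)) (at t within T)"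
proof -
  have "(u has_derivative frechet_derivative u (at (p t))) (at (p t) within p ` T)"
    using assms(1) frechet_derivative_works has_derivative_at_withinI by blast
  then interpret bounded_linear "frechet_derivative u (at (p t))"
    using has_derivative_bounded_linear by blast
  have "((u \<circ> p) has_derivative (frechet_derivative u (at (p t)) \<circ> (\<lambda>x. x *\<^sub>R v))) (at t within T)"
    by (rule diff_chain_within)
      (use assms \<open>(u has_derivative _) _\<close> in \<open>auto simp: has_vector_derivative_def\<close>)
  then show ?thesis
    by (simp add: has_vector_derivative_def dir_deriv_def o_def scaleR)
qed

lemma dir_deriv_eqI:
  assumes "(f has_derivative f') (at z)"
  shows "dir_deriv v f z = f' v"
  using assms by (metis dir_deriv_def frechet_derivative_at)

lemma dir_deriv_cong_open:
  assumes "open S" "z \<in> S" "\<And>y. y \<in> S \<Longrightarrow> f y = g y"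
  shows "dir_deriv v f z = dir_deriv v g z"
proof -
  have "(f has_derivative D) (at z) \<longleftrightarrow> (g has_derivative D) (at z)" for D
    using assms has_derivative_transform_within_open[of f D z UNIV S g]
      has_derivative_transform_within_open[of g D z UNIV S f] by auto
  then show ?thesis
    by (simp add: dir_deriv_def frechet_derivative_def)
qed

lemma differentiable_cong_open:
  assumes "open S" "z \<in> S" "\<And>y. y \<in> S \<Longrightarrow> f y = g y" "f differentiable (at z)"
  shows "g differentiable (at z)"
  using assms has_derivative_transform_within_open[of f _ z UNIV S g]
  unfolding differentiable_def by auto

lemma dir_deriv_scaleR:
  assumes "f differentiable (at z)"
  shows "dir_deriv v (\<lambda>y. c *\<^sub>R f y) z = c *\<^sub>R dir_deriv v f z"
proof -
  have "(f has_derivative frechet_derivative f (at z)) (at z)"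
    using assms frechet_derivative_works by blast
  from dir_deriv_eqI[OF has_derivative_scaleR_right[OF this], of v c] show ?thesis
    by (simp add: dir_deriv_def)
qed

lemma C1_on_subset: "C1_on S f \<Longrightarrow> T \<subseteq> S \<Longrightarrow> C1_on T f"
  unfolding C1_on_def using continuous_on_subset by blast

lemma C2_on_subset: "C2_on S f \<Longrightarrow> T \<subseteq> S \<Longrightarrow> C2_on T f"
  unfolding C2_on_def using C1_on_subset by blast

lemma C1_on_continuous_on: "C1_on S f \<Longrightarrow> continuous_on S f"
  unfolding C1_on_def
  by (meson continuous_at_imp_continuous_on differentiable_imp_continuous_within)

lemma C1_on_cong_open:
  assumes "open S" "\<And>y. y \<in> S \<Longrightarrow> f y = g y" "C1_on S f"
  shows "C1_on S g"
  using assms differentiable_cong_open[of S _ f g] dir_deriv_cong_open[of S _ f g]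
  unfolding C1_on_def by (auto cong: continuous_on_cong)

text \<open>Symmetry of second derivatives, stated at a corner so that one-sided derivatives do.
  Writing \<open>f x y\<close> as \<open>f x0 y\<close> plus the integral of \<open>fx\<close> and
  differentiating in y under the integral gives \<open>fy x y0\<close> as an integral of
  \<open>fxy\<close>; differentiating that in x gives \<open>fxy x0 y0\<close>.\<close>

lemma mixed_partials_real:
  fixes f :: "real \<Rightarrow> real \<Rightarrow> complex"
  assumes "x0 < x1" "y0 < y1"
    and fx: "\<And>x y. x \<in> {x0..x1} \<Longrightarrow> y \<in> {y0..y1} \<Longrightarrow>
      ((\<lambda>x. f x y) has_vector_derivative fx x y) (at x within {x0..x1})"
    and fy: "\<And>x y. x \<in> {x0..x1} \<Longrightarrow> y \<in> {y0..y1} \<Longrightarrow>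
      ((\<lambda>y. f x y) has_vector_derivative fy x y) (at y within {y0..y1})"
    and fxy: "\<And>x y. x \<in> {x0..x1} \<Longrightarrow> y \<in> {y0..y1} \<Longrightarrow>
      ((\<lambda>y. fx x y) has_vector_derivative fxy x y) (at y within {y0..y1})"
    and fyx: "((\<lambda>x. fy x y0) has_vector_derivative d) (at x0 within {x0..x1})"
    and cont: "continuous_on ({x0..x1} \<times> {y0..y1}) (\<lambda>(x, y). fxy x y)"
    and cont_fx: "continuous_on ({x0..x1} \<times> {y0..y1}) (\<lambda>(x, y). fx x y)"
  shows "d = fxy x0 y0"
proof -
  have cx: "continuous_on {x0..x} (\<lambda>s. fx s y)" if "x \<in> {x0..x1}" "y \<in> {y0..y1}" for x y
    by (rule continuous_on_compose2[OF cont_fx, of _ "\<lambda>s. (s, y)", simplified])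
      (use that in \<open>auto intro!: continuous_intros\<close>)
  have eq: "fy x y0 = fy x0 y0 + integral {x0..x} (\<lambda>s. fxy s y0)" if x: "x \<in> {x0..x1}" for x
  proof -
    have lhs: "((\<lambda>y. f x0 y + integral (cbox x0 x) (\<lambda>s. fx s y)) has_vector_derivative
        fy x0 y0 + integral (cbox x0 x) (\<lambda>s. fxy s y0)) (at y0 within {y0..y1})"
    proof (intro has_vector_derivative_add fy leibniz_rule_vector_derivative)
      show "continuous_on ({y0..y1} \<times> cbox x0 x) (\<lambda>(y, s). fxy s y)"
      proof -
        have "continuous_on ({y0..y1} \<times> cbox x0 x) (\<lambda>p. (snd p, fst p))"
          by (intro continuous_intros)
        moreover have "(\<lambda>p. (snd p, fst p)) ` ({y0..y1} \<times> cbox x0 x) \<subseteq> {x0..x1} \<times> {y0..y1}"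
          using x by auto
        ultimately show ?thesis
          using continuous_on_compose2[OF cont, of "{y0..y1} \<times> cbox x0 x" "\<lambda>p. (snd p, fst p)"]
          by (simp add: case_prod_unfold)
      qed
    qed (use x \<open>x0 < x1\<close> \<open>y0 < y1\<close> in \<open>auto intro!: fxy integrable_continuous_real cx\<close>)
    have ftc: "f x y = f x0 y + integral (cbox x0 x) (\<lambda>s. fx s y)" if y: "y \<in> {y0..y1}" for y
    proof -
      have "((\<lambda>s. fx s y) has_integral f x y - f x0 y) {x0..x}"
        by (rule fundamental_theorem_of_calculus)
          (use x y in \<open>auto intro!: has_vector_derivative_within_subset[OF fx]\<close>)
      then show ?thesis
        by (simp add: integral_unique)
    qed
    have "((\<lambda>y. f x y) has_vector_derivative
        fy x0 y0 + integral {x0..x} (\<lambda>s. fxy s y0)) (at y0 within {y0..y1})"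
      using has_vector_derivative_transform[OF _ ftc lhs] \<open>y0 < y1\<close> by simp
    moreover have "((\<lambda>y. f x y) has_vector_derivative fy x y0) (at y0 within {y0..y1})"
      using x \<open>y0 < y1\<close> by (intro fy) auto
    ultimately show ?thesis
      using vector_derivative_unique_within_closed_interval[of y0 y1 y0] \<open>y0 < y1\<close> by auto
  qed
  have "((\<lambda>x. fy x0 y0 + integral {x0..x} (\<lambda>s. fxy s y0)) has_vector_derivative fxy x0 y0)
      (at x0 within {x0..x1})"
  proof -
    have "continuous_on {x0..x1} (\<lambda>s. fxy s y0)"
      by (rule continuous_on_compose2[OF cont, of _ "\<lambda>s. (s, y0)", simplified])
        (use \<open>y0 < y1\<close> in \<open>auto intro!: continuous_intros\<close>)
    then have "((\<lambda>x. integral {x0..x} (\<lambda>s. fxy s y0)) has_vector_derivative fxy x0 y0)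
        (at x0 within {x0..x1})"
      by (rule integral_has_vector_derivative) (use \<open>x0 < x1\<close> in auto)
    from has_vector_derivative_add[OF has_vector_derivative_const this] show ?thesis by simp
  qed
  note integral_deriv = this
  have "((\<lambda>x. fy x y0) has_vector_derivative fxy x0 y0) (at x0 within {x0..x1})"
    by (rule has_vector_derivative_transform[OF _ eq integral_deriv]) (use \<open>x0 < x1\<close> in simp_all)
  then show ?thesis
    using fyx vector_derivative_unique_within_closed_interval[of x0 x1 x0] \<open>x0 < x1\<close> by auto
qed

lemma mixed_partials:
  assumes "open S" "C2_on S u" "z \<in> S"
  shows "dir_deriv 1 (dir_deriv \<i> u) z = dir_deriv \<i> (dir_deriv 1 u) z"
proof -
  obtain e where "e > 0" and e: "cball z e \<subseteq> S"
    using assms open_contains_cball by blast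
  \<comment> \<open>Halving \<open>e\<close> keeps the rectangle inside the ball, since the modulus
    is at most the sum of the absolute values of both coordinates.\<close>
  define x1 y1 where "x1 = Re z + e / 2" and "y1 = Im z + e / 2"
  have mem: "Complex x y \<in> S" if "x \<in> {Re z..x1}" "y \<in> {Im z..y1}" for x y
  proof -
    have "norm (z - Complex x y) \<le> \<bar>Re (z - Complex x y)\<bar> + \<bar>Im (z - Complex x y)\<bar>"
      by (rule cmod_le)
    also have "\<dots> \<le> e"
      using that by (auto simp: x1_def y1_def)
    finally show ?thesis
      using e by (auto simp: dist_norm)
  qed
  have px: "((\<lambda>x. Complex x y) has_vector_derivative 1) (at x within T)" for x y T
    unfolding Complex_eq by (auto intro!: derivative_eq_intros)
  have py: "((\<lambda>y. Complex x y) has_vector_derivative \<i>) (at y within T)" for x y T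
    unfolding Complex_eq by (auto intro!: derivative_eq_intros)
  have C: "C1_on S u" "C1_on S (dir_deriv 1 u)" "C1_on S (dir_deriv \<i> u)"
    using assms(2) by (auto simp: C2_on_def)
  have cont: "continuous_on ({Re z..x1} \<times> {Im z..y1}) (\<lambda>(x, y). g (Complex x y))"
    if "continuous_on S g" for g :: "complex \<Rightarrow> complex"
    unfolding case_prod_unfold
    by (rule continuous_on_compose2[OF that]) (auto intro!: continuous_intros mem)
  have "dir_deriv 1 (dir_deriv \<i> u) (Complex (Re z) (Im z)) = dir_deriv \<i> (dir_deriv 1 u) (Complex (Re z) (Im z))"
  proof (rule mixed_partials_real[of "Re z" x1 "Im z" y1 "\<lambda>x y. u (Complex x y)"
        "\<lambda>x y. dir_deriv 1 u (Complex x y)" "\<lambda>x y. dir_deriv \<i> u (Complex x y)"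
        "\<lambda>x y. dir_deriv \<i> (dir_deriv 1 u) (Complex x y)"])
    show "continuous_on ({Re z..x1} \<times> {Im z..y1}) (\<lambda>(x, y). dir_deriv 1 u (Complex x y))"
      "continuous_on ({Re z..x1} \<times> {Im z..y1}) (\<lambda>(x, y). dir_deriv \<i> (dir_deriv 1 u) (Complex x y))"
      using C by (intro cont; simp add: C1_on_def)+
    show "((\<lambda>x. dir_deriv \<i> u (Complex x (Im z))) has_vector_derivative
        dir_deriv 1 (dir_deriv \<i> u) (Complex (Re z) (Im z))) (at (Re z) within {Re z..x1})"
      using C assms(3) by (intro has_vector_derivative_dir_deriv px) (simp add: C1_on_def)
  qed (use C \<open>e > 0\<close> in \<open>auto intro!: has_vector_derivative_dir_deriv px py simp: C1_on_def mem\<close>, auto simp: x1_def y1_def)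
  then show ?thesis by simp
qed

section \<open>Fourier coefficients on circles\<close>

definition fourier :: "(complex \<Rightarrow> complex) \<Rightarrow> int \<Rightarrow> real \<Rightarrow> complex" where
  "fourier g m \<rho> = integral {0..2*pi} (\<lambda>t. g (rcis \<rho> t) * cis (- (of_int m * t)))"

lemma continuous_on_fourier_kernel:
  assumes "continuous_on (norm -` {\<bar>\<rho>\<bar>}) g"
  shows "continuous_on {0..2*pi} (\<lambda>t. g (rcis \<rho> t) * cis (- (of_int m * t)))"
  by (intro continuous_intros continuous_on_compose2[OF assms]) auto

lemma continuous_on_fourier:
  assumes "continuous_on (norm -` I) g" and "I \<subseteq> {0..}"
  shows "continuous_on I (fourier g m)"
proof -
  have "continuous_on I (\<lambda>\<rho>. integral (cbox 0 (2*pi)) (\<lambda>t. g (rcis \<rho> t) * cis (- (of_int m * t))))"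
    by (rule integral_continuous_on_param)
      (use assms(2) in \<open>auto simp: case_prod_unfold intro!: continuous_intros continuous_on_compose2[OF assms(1)]\<close>)
  then show ?thesis
    by (simp add: fourier_def[abs_def])
qed

lemma fourier_cong:
  assumes "\<And>z. norm z = \<bar>\<rho>\<bar> \<Longrightarrow> f z = g z"
  shows "fourier f m \<rho> = fourier g m \<rho>"
  unfolding fourier_def by (intro integral_cong) (simp add: assms)

lemma fourier_add:
  assumes "continuous_on (norm -` {\<bar>\<rho>\<bar>}) f" "continuous_on (norm -` {\<bar>\<rho>\<bar>}) g"
  shows "fourier (\<lambda>z. f z + g z) m \<rho> = fourier f m \<rho> + fourier g m \<rho>"
  using continuous_on_fourier_kernel[OF assms(1)] continuous_on_fourier_kernel[OF assms(2)]
  unfolding fourier_def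
  by (subst integral_add[symmetric]) (auto intro!: integrable_continuous_real simp: algebra_simps)

lemma fourier_mult_left: "fourier (\<lambda>z. c * g z) m \<rho> = c * fourier g m \<rho>"
  unfolding fourier_def by (subst integral_mult_right[symmetric]) (simp add: mult.assoc)

lemma fourier_diff:
  assumes "continuous_on (norm -` {\<bar>\<rho>\<bar>}) f" "continuous_on (norm -` {\<bar>\<rho>\<bar>}) g"
  shows "fourier (\<lambda>z. f z - g z) m \<rho> = fourier f m \<rho> - fourier g m \<rho>"
  using fourier_add[of \<rho> f "\<lambda>z. (-1) * g z" m] fourier_mult_left[of "-1" g m \<rho>] assms
  by (auto intro!: continuous_intros)

lemma fourier_zero: "fourier (\<lambda>z. 0) m \<rho> = 0"
  by (simp add: fourier_def)

lemma fourier_sum: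
  assumes "finite S" "\<And>k. k \<in> S \<Longrightarrow> continuous_on (norm -` {\<bar>\<rho>\<bar>}) (f k)"
  shows "fourier (\<lambda>z. \<Sum>k\<in>S. f k z) m \<rho> = (\<Sum>k\<in>S. fourier (f k) m \<rho>)"
  using assms
  by (induction S rule: finite_induct)
    (auto simp: fourier_zero intro!: fourier_add[THEN trans] continuous_on_sum)

lemma fourier_cnj: "fourier (\<lambda>z. cnj (g z)) m \<rho> = cnj (fourier g (- m) \<rho>)"
proof -
  have "(\<lambda>t. cnj (g (rcis \<rho> t)) * cis (- (of_int m * t))) =
      (\<lambda>t. cnj (g (rcis \<rho> t) * cis (- (of_int (- m) * t))))"
    by (simp add: cis_cnj)
  then show ?thesis
    unfolding fourier_def integral_cnj by simp
qed

lemma norm_fourier_le: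
  assumes "continuous_on (norm -` {\<bar>\<rho>\<bar>}) g" "\<And>z. norm z = \<bar>\<rho>\<bar> \<Longrightarrow> norm (g z) \<le> B"
  shows "norm (fourier g m \<rho>) \<le> 2 * pi * B"
proof -
  have "norm (fourier g m \<rho>) \<le> B * (2 * pi - 0)"
    unfolding fourier_def
    by (rule integral_bound) (use assms in \<open>auto intro!: continuous_on_fourier_kernel simp: norm_mult\<close>)
  then show ?thesis by (simp add: mult.commute)
qed

lemma integral_cis_int:
  "integral {0..2*pi} (\<lambda>t. cis (of_int m * t)) = (if m = 0 then 2 * pi else 0)"
proof (cases "m = 0")
  case False
  have "((\<lambda>t. cis (of_int m * t)) has_integral
      cis (of_int m * (2 * pi)) / (\<i> * of_int m) - cis (of_int m * 0) / (\<i> * of_int m)) {0..2*pi}"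
    by (rule fundamental_theorem_of_calculus)
      (use False in \<open>auto intro!: derivative_eq_intros simp: has_vector_derivative_def scaleR_conv_of_real fun_eq_iff complex_eq_iff\<close>)
  moreover have "cis (of_int m * (2 * pi)) = 1"
    using cis_multiple_2pi[of "of_int m"] by (simp add: mult_ac)
  ultimately show ?thesis
    using False by (simp add: integral_unique)
qed (simp add: scaleR_conv_of_real)

lemma fourier_powi:
  assumes "\<rho> \<noteq> 0"
  shows "fourier (\<lambda>z. z powi k) m \<rho> = (if k = m then 2 * pi * \<rho> powi k else 0)"
proof -
  have "(\<lambda>t. rcis \<rho> t powi k * cis (- (of_int m * t))) =
      (\<lambda>t. of_real (\<rho> powi k) * cis (of_int (k - m) * t))"
    by (auto simp: rcis_def power_int_mult_distrib cis_power_int mult.assoc cis_mult algebra_simps)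
  then show ?thesis
    unfolding fourier_def by (simp only: integral_mult_right integral_cis_int) auto
qed

section \<open>Fourier coefficients of angular and radial derivatives\<close>

lemma has_vector_derivative_rcis_angle:
  "((\<lambda>t. rcis \<rho> t) has_vector_derivative \<i> * rcis \<rho> t) (at t within T)"
  unfolding rcis_def has_vector_derivative_def
  by (auto intro!: derivative_eq_intros simp: scaleR_conv_of_real)

lemma has_vector_derivative_rcis_radius:
  "((\<lambda>\<rho>. rcis \<rho> t) has_vector_derivative cis t) (at \<rho> within T)"
  unfolding rcis_def has_vector_derivative_def
  by (auto intro!: derivative_eq_intros simp: scaleR_conv_of_real)

lemma rcis_2pi: "rcis \<rho> (2 * pi) = rcis \<rho> 0"
  by (simp add: rcis_def)

text \<open>\<open>\<i> * z\<close> is the velocity of \<open>rcis \<rho> t\<close> in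
  \<open>t\<close>, so this is integration by parts over a full period; the boundary terms cancel by
  periodicity.\<close>

lemma fourier_angular_derivative:
  assumes "open S" "C1_on S u" "norm -` {\<bar>\<rho>\<bar>} \<subseteq> S"
  shows "fourier (\<lambda>z. dir_deriv (\<i> * z) u z) m \<rho> = \<i> * of_int m * fourier u m \<rho>"
proof -
  have S: "rcis \<rho> t \<in> S" for t
    using assms(3) by auto
  have dir: "dir_deriv (\<i> * z) u z = Re (\<i> * z) *\<^sub>R dir_deriv 1 u z + Im (\<i> * z) *\<^sub>R dir_deriv \<i> u z"
    if "z \<in> S" for z
    using assms that by (intro dir_deriv_eq) (auto simp: C1_on_def)
  have "continuous_on S (\<lambda>z. dir_deriv (\<i> * z) u z)"
    using assms(2) by (subst continuous_on_cong[OF refl dir]) (auto simp: C1_on_def intro!: continuous_intros)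
  then have cd: "continuous_on {0..2*pi} (\<lambda>t. dir_deriv (\<i> * rcis \<rho> t) u (rcis \<rho> t) * cis (- (of_int m * t)))"
    using assms(3) by (intro continuous_on_fourier_kernel[where g = "\<lambda>z. dir_deriv (\<i> * z) u z"])
      (rule continuous_on_subset)
  have "continuous_on S u"
    using assms(2) by (rule C1_on_continuous_on)
  then have cu: "continuous_on {0..2*pi} (\<lambda>t. u (rcis \<rho> t) * cis (- (of_int m * t)))"
    using assms(3) by (intro continuous_on_fourier_kernel) (rule continuous_on_subset)
  have "((\<lambda>t. dir_deriv (\<i> * rcis \<rho> t) u (rcis \<rho> t) * cis (- (of_int m * t)) +
        (- \<i> * of_int m) * (u (rcis \<rho> t) * cis (- (of_int m * t)))) has_integral
        u (rcis \<rho> (2*pi)) * cis (- (of_int m * (2*pi))) - u (rcis \<rho> 0) * cis (- (of_int m * 0))) {0..2*pi}"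
  proof (rule fundamental_theorem_of_calculus)
    fix t
    have du: "((\<lambda>t. u (rcis \<rho> t)) has_vector_derivative dir_deriv (\<i> * rcis \<rho> t) u (rcis \<rho> t)) (at t within {0..2*pi})"
      using assms(2) S by (intro has_vector_derivative_dir_deriv has_vector_derivative_rcis_angle) (auto simp: C1_on_def)
    have "((\<lambda>t. cis (- (of_int m * t))) has_vector_derivative - \<i> * of_int m * cis (- (of_int m * t)))
        (at t within {0..2*pi})"
      by (auto intro!: derivative_eq_intros simp: has_vector_derivative_def scaleR_conv_of_real)
    from has_vector_derivative_mult[OF du this] show "((\<lambda>t. u (rcis \<rho> t) * cis (- (of_int m * t))) has_vector_derivative
        dir_deriv (\<i> * rcis \<rho> t) u (rcis \<rho> t) * cis (- (of_int m * t)) +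
        (- \<i> * of_int m) * (u (rcis \<rho> t) * cis (- (of_int m * t)))) (at t within {0..2*pi})"
      by (simp add: algebra_simps)
  qed simp
  moreover have "cis (- (of_int m * (2*pi))) = 1"
    using cis_multiple_2pi[of "of_int (- m)"] by (simp add: mult_ac)
  ultimately have "integral {0..2*pi} (\<lambda>t. dir_deriv (\<i> * rcis \<rho> t) u (rcis \<rho> t) * cis (- (of_int m * t)) +
        (- \<i> * of_int m) * (u (rcis \<rho> t) * cis (- (of_int m * t)))) = 0"
    by (simp add: integral_unique rcis_2pi del: rcis_zero_arg)
  then have "integral {0..2*pi} (\<lambda>t. dir_deriv (\<i> * rcis \<rho> t) u (rcis \<rho> t) * cis (- (of_int m * t))) +
      (- \<i> * of_int m) * integral {0..2*pi} (\<lambda>t. u (rcis \<rho> t) * cis (- (of_int m * t))) = 0"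
    by (subst integral_mult_right[symmetric], subst integral_add[symmetric])
      (use cd cu in \<open>auto intro!: integrable_continuous_real continuous_intros\<close>)
  then show ?thesis
    by (simp add: fourier_def)
qed

text \<open>Differentiation under the integral produces the derivative along the unit vector
  \<open>cis t\<close>; \<open>dir_deriv z u z\<close> is \<rho> times that, whence the division.
  Other frequencies are moved to 0 by \<open>fourier_shift\<close>.\<close>

lemma fourier_zero_has_vector_derivative:
  assumes I: "open I" "convex I" "I \<subseteq> {0<..}" and u: "C1_on (norm -` I) u" and "\<rho> \<in> I"
  shows "(fourier u 0 has_vector_derivative fourier (\<lambda>z. dir_deriv z u z) 0 \<rho> / \<rho>) (at \<rho>)"
proof -
  let ?S = "norm -` I :: complex set"
  have S: "rcis \<rho> t \<in> ?S" if "\<rho> \<in> I" for \<rho> t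
    using that I by auto
  have dir: "dir_deriv v u z = Re v *\<^sub>R dir_deriv 1 u z + Im v *\<^sub>R dir_deriv \<i> u z"
    if "z \<in> ?S" for v z
    using u that by (intro dir_deriv_eq) (auto simp: C1_on_def)
  have c1: "continuous_on (I \<times> T) (\<lambda>p. g (rcis (fst p) (snd p)))"
    if "continuous_on ?S g" for g and T :: "real set"
    by (rule continuous_on_compose2[OF that]) (use S in \<open>auto intro!: continuous_intros\<close>)
  have cont: "continuous_on (I \<times> cbox 0 (2*pi)) (\<lambda>(\<rho>, t). dir_deriv (cis t) u (rcis \<rho> t))"
  proof (rule continuous_on_eq)
    show "continuous_on (I \<times> cbox 0 (2*pi)) (\<lambda>p. Re (cis (snd p)) *\<^sub>R dir_deriv 1 u (rcis (fst p) (snd p)) +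
        Im (cis (snd p)) *\<^sub>R dir_deriv \<i> u (rcis (fst p) (snd p)))"
      using u by (intro continuous_intros c1) (auto simp: C1_on_def)
    show "Re (cis (snd p)) *\<^sub>R dir_deriv 1 u (rcis (fst p) (snd p)) +
        Im (cis (snd p)) *\<^sub>R dir_deriv \<i> u (rcis (fst p) (snd p)) =
        (case p of (\<rho>, t) \<Rightarrow> dir_deriv (cis t) u (rcis \<rho> t))" if "p \<in> I \<times> cbox 0 (2*pi)" for p
      using that dir[OF S, of "fst p" "cis (snd p)" "snd p"] by (simp add: case_prod_unfold mem_Times_iff)
  qed
  have deriv: "((\<lambda>\<rho>. integral (cbox 0 (2*pi)) (\<lambda>t. u (rcis \<rho> t))) has_vector_derivative
      integral (cbox 0 (2*pi)) (\<lambda>t. dir_deriv (cis t) u (rcis \<rho> t))) (at \<rho> within I)"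
  proof (rule leibniz_rule_vector_derivative[OF _ _ cont \<open>\<rho> \<in> I\<close> \<open>convex I\<close>])
    show "((\<lambda>\<rho>. u (rcis \<rho> t)) has_vector_derivative dir_deriv (cis t) u (rcis \<rho> t)) (at \<rho> within I)"
      if "\<rho> \<in> I" for \<rho> t
      using u S[OF that] by (intro has_vector_derivative_dir_deriv has_vector_derivative_rcis_radius) (auto simp: C1_on_def)
    show "(\<lambda>t. u (rcis \<rho> t)) integrable_on cbox 0 (2*pi)" if "\<rho> \<in> I" for \<rho>
      by (intro integrable_continuous, rule continuous_on_compose2[OF C1_on_continuous_on[OF u]])
        (use S[OF that] in \<open>auto intro!: continuous_intros\<close>)
  qed
  have "dir_deriv (rcis \<rho> t) u (rcis \<rho> t) = \<rho> * dir_deriv (cis t) u (rcis \<rho> t)" for t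
    using dir[OF S[OF \<open>\<rho> \<in> I\<close>], of "rcis \<rho> t" t] dir[OF S[OF \<open>\<rho> \<in> I\<close>], of "cis t" t]
    by (simp add: algebra_simps scaleR_conv_of_real)
  then have "fourier (\<lambda>z. dir_deriv z u z) 0 \<rho> = \<rho> * integral (cbox 0 (2*pi)) (\<lambda>t. dir_deriv (cis t) u (rcis \<rho> t))"
    by (simp add: fourier_def)
  moreover have "\<rho> > 0"
    using \<open>\<rho> \<in> I\<close> I by auto
  moreover have "fourier u 0 = (\<lambda>\<rho>. integral (cbox 0 (2*pi)) (\<lambda>t. u (rcis \<rho> t)))"
    by (simp add: fourier_def fun_eq_iff)
  ultimately show ?thesis
    using deriv at_within_open[OF \<open>\<rho> \<in> I\<close> \<open>open I\<close>] by simp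
qed

text \<open>Cauchy's theorem for concentric circles. For holomorphic \<open>h\<close> the radial
  derivative \<open>h' z * z\<close> is \<open>- \<i>\<close> times the angular one, and angular
  derivatives have mean zero.\<close>

lemma holomorphic_fourier_zero_const:
  assumes I: "open I" "convex I" "I \<subseteq> {0<..}"
    and h: "\<And>z. norm z \<in> I \<Longrightarrow> (h has_field_derivative h' z) (at z)"
    and h': "continuous_on (norm -` I) h'"
  shows "\<exists>A. \<forall>\<rho>\<in>I. fourier h 0 \<rho> = A"
proof -
  let ?S = "norm -` I :: complex set"
  have dir: "dir_deriv v h z = h' z * v" if "z \<in> ?S" for v z
    using dir_deriv_eqI h that by (fastforce simp: has_field_derivative_def)
  have "open ?S"
    using \<open>open I\<close> by (intro open_vimage continuous_intros)
  have C1: "C1_on ?S h"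
    unfolding C1_on_def
  proof (intro conjI ballI)
    show "h differentiable (at z)" if "z \<in> ?S" for z
      using h that by (auto simp: has_field_derivative_def differentiable_def)
    have "continuous_on ?S (dir_deriv v h)" for v
      by (subst continuous_on_cong[OF refl dir]) (auto intro!: continuous_intros h')
    then show "continuous_on ?S (dir_deriv 1 h)" "continuous_on ?S (dir_deriv \<i> h)"
      by this+
  qed
  have "fourier (\<lambda>z. dir_deriv z h z) 0 \<rho> = 0" if "\<rho> \<in> I" for \<rho>
  proof -
    have sub: "norm -` {\<bar>\<rho>\<bar>} \<subseteq> ?S"
      using that I by auto
    have "fourier (\<lambda>z. dir_deriv z h z) 0 \<rho> = fourier (\<lambda>z. - \<i> * dir_deriv (\<i> * z) h z) 0 \<rho>"
    proof (rule fourier_cong)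
      fix z :: complex
      assume "norm z = \<bar>\<rho>\<bar>"
      then have "dir_deriv z h z = h' z * z" "dir_deriv (\<i> * z) h z = h' z * (\<i> * z)"
        using sub by (auto intro!: dir)
      then show "dir_deriv z h z = - \<i> * dir_deriv (\<i> * z) h z"
        by (simp add: complex_eq_iff)
    qed
    also have "\<dots> = 0"
      unfolding fourier_mult_left fourier_angular_derivative[OF \<open>open ?S\<close> C1 sub] by simp
    finally show ?thesis .
  qed
  then have "(fourier h 0 has_vector_derivative 0) (at \<rho> within I)" if "\<rho> \<in> I" for \<rho>
    using fourier_zero_has_vector_derivative[OF I C1 that] that
    by (auto intro: has_vector_derivative_at_within)
  then show ?thesis
    using has_vector_derivative_zero_constant[OF \<open>convex I\<close>] by metis
qed

section \<open>Fourier coefficients of harmonic functions on annuli\<close>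

definition laplacian :: "(complex \<Rightarrow> complex) \<Rightarrow> complex \<Rightarrow> complex" where
  "laplacian u z = dir_deriv 1 (dir_deriv 1 u) z + dir_deriv \<i> (dir_deriv \<i> u) z"

text \<open>The relation between the partial derivatives is the Cauchy-Riemann equation, which makes
  the real derivative complex linear.\<close>

lemma has_field_derivative_of_dir_deriv:
  assumes "g differentiable (at z)" "dir_deriv \<i> g z = \<i> * dir_deriv 1 g z"
  shows "(g has_field_derivative dir_deriv 1 g z) (at z)"
proof -
  have "frechet_derivative g (at z) v = dir_deriv 1 g z * v" for v
    using dir_deriv_eq[OF assms(1), of v] assms(2)
    by (simp add: dir_deriv_def complex_eq_iff algebra_simps)
  then have "frechet_derivative g (at z) = (*) (dir_deriv 1 g z)"
    by auto
  then show ?thesis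
    using assms(1) by (metis frechet_derivative_works has_field_derivative_def)
qed

lemma dir_deriv_add_mult:
  assumes "f differentiable (at z)" "g differentiable (at z)"
  shows "dir_deriv v (\<lambda>y. f y + c * g y) z = dir_deriv v f z + c * dir_deriv v g z"
    and "(\<lambda>y. f y + c * g y) differentiable (at z)"
proof -
  have "((\<lambda>y. f y + c * g y) has_derivative
      (\<lambda>v. frechet_derivative f (at z) v + c * frechet_derivative g (at z) v)) (at z)"
    using assms by (auto intro!: derivative_intros simp: frechet_derivative_works)
  then show "dir_deriv v (\<lambda>y. f y + c * g y) z = dir_deriv v f z + c * dir_deriv v g z"
    "(\<lambda>y. f y + c * g y) differentiable (at z)"
    by (auto simp: dir_deriv_eqI differentiable_def) (simp add: dir_deriv_def)
qed

text \<open>On the circle the kernel cis (-m t) equals \<rho>^m z^(-m). The m-th coefficient thus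
  becomes the zeroth one of a function that is holomorphic whenever \<open>g\<close> is, and
  \<open>holomorphic_fourier_zero_const\<close> can be applied.\<close>

lemma fourier_shift:
  assumes "\<rho> \<noteq> 0"
  shows "fourier (\<lambda>z. z * g z) m \<rho> = \<rho> powi m * fourier (\<lambda>z. z powi (1 - m) * g z) 0 \<rho>"
proof -
  have "rcis \<rho> t * g (rcis \<rho> t) * cis (- (of_int m * t)) =
      \<rho> powi m * (rcis \<rho> t powi (1 - m) * g (rcis \<rho> t) * cis (- (of_int 0 * t)))" for t
  proof -
    have "rcis \<rho> t powi (1 - m) = rcis \<rho> t / rcis \<rho> t powi m"
      using assms by (simp add: power_int_diff)
    moreover have "rcis \<rho> t powi m = \<rho> powi m * cis (of_int m * t)"
      by (simp add: rcis_def power_int_mult_distrib cis_power_int)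
    ultimately show ?thesis
      using assms by (simp add: cis_inverse[symmetric] field_simps)
  qed
  then show ?thesis
    unfolding fourier_def by (simp only: integral_mult_right of_real_power_int)
qed

text \<open>\<open>G\<close>, twice the Wirtinger derivative of u in z, is holomorphic for harmonic
  u. Moreover z G is the radial derivative minus \<i> times the angular one, and the latter
  contributes the factor \<i> m, hence the summand with \<open>of_int m\<close>. The constant
  \<open>A\<close> is the zeroth coefficient of z^(1-m) G.\<close>

lemma harmonic_fourier_holomorphic_part:
  assumes I: "open I" "convex I" "I \<subseteq> {0<..}" and u: "C2_on (norm -` I) u"
    and harm: "\<And>z. norm z \<in> I \<Longrightarrow> laplacian u z = 0"
  shows "\<exists>A :: complex. \<forall>\<rho>\<in>I. fourier (\<lambda>z. dir_deriv z u z) m \<rho> + of_int m * fourier u m \<rho> = A * \<rho> powi m"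
proof -
  let ?S = "norm -` I :: complex set"
  define G where "G = (\<lambda>z. dir_deriv 1 u z + (- \<i>) * dir_deriv \<i> u z)"
  let ?h = "\<lambda>z. z powi (1 - m) * G z"
  have "open ?S"
    using \<open>open I\<close> by (intro open_vimage continuous_intros)
  have C: "C1_on ?S u" "C1_on ?S (dir_deriv 1 u)" "C1_on ?S (dir_deriv \<i> u)"
    using u by (auto simp: C2_on_def)
  have nz: "z \<noteq> 0" if "norm z \<in> I" for z :: complex
    using that I by auto
  have G': "dir_deriv v G z = dir_deriv v (dir_deriv 1 u) z + (- \<i>) * dir_deriv v (dir_deriv \<i> u) z"
    "G differentiable (at z)" if "norm z \<in> I" for v z
    using dir_deriv_add_mult[where f = "dir_deriv 1 u" and g = "dir_deriv \<i> u" and c = "- \<i>"] C that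
    unfolding G_def by (simp_all add: C1_on_def)
  \<comment> \<open>Cauchy-Riemann for \<open>G\<close>: harmonicity handles the pure second
    derivatives, \<open>mixed_partials\<close> the mixed ones.\<close>
  have dG: "(G has_field_derivative dir_deriv 1 G z) (at z)" if z: "norm z \<in> I" for z
  proof (rule has_field_derivative_of_dir_deriv[OF G'(2)[OF z]])
    have "dir_deriv \<i> (dir_deriv \<i> u) z = - dir_deriv 1 (dir_deriv 1 u) z"
      using harm[OF z] by (simp add: laplacian_def eq_neg_iff_add_eq_0 add.commute)
    moreover have "dir_deriv 1 (dir_deriv \<i> u) z = dir_deriv \<i> (dir_deriv 1 u) z"
      using mixed_partials[OF \<open>open ?S\<close> u] z by simp
    ultimately show "dir_deriv \<i> G z = \<i> * dir_deriv 1 G z"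
      unfolding G'(1)[OF z] by (simp add: algebra_simps)
  qed
  have h': "(?h has_field_derivative
      z powi (1 - m) * dir_deriv 1 G z + of_int (1 - m) * z powi (1 - m - 1) * G z) (at z)"
    if "norm z \<in> I" for z
    using nz[OF that] by (auto intro!: derivative_eq_intros dG that simp: mult.commute)
  have cG': "continuous_on ?S (dir_deriv 1 G)"
  proof (subst continuous_on_cong[OF refl G'(1)])
    show "continuous_on ?S (\<lambda>z. dir_deriv 1 (dir_deriv 1 u) z + (- \<i>) * dir_deriv 1 (dir_deriv \<i> u) z)"
      using C by (intro continuous_intros) (auto simp: C1_on_def)
  qed simp
  have cG: "continuous_on ?S G"
    unfolding G_def using C by (intro continuous_intros) (auto simp: C1_on_def)
  have "continuous_on ?S (\<lambda>z. z powi (1 - m) * dir_deriv 1 G z + of_int (1 - m) * z powi (1 - m - 1) * G z)"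
    using nz by (intro continuous_intros cG' cG) auto
  then obtain A :: complex where A: "\<And>\<rho>. \<rho> \<in> I \<Longrightarrow> fourier ?h 0 \<rho> = A"
    using holomorphic_fourier_zero_const[OF I h'] by blast
  have "fourier (\<lambda>z. dir_deriv z u z) m \<rho> + of_int m * fourier u m \<rho> = A * \<rho> powi m" if "\<rho> \<in> I" for \<rho>
  proof -
    have \<rho>: "\<rho> > 0" and sub: "norm -` {\<bar>\<rho>\<bar>} \<subseteq> ?S"
      using that I by auto
    have dir: "dir_deriv v u z = Re v *\<^sub>R dir_deriv 1 u z + Im v *\<^sub>R dir_deriv \<i> u z" if "norm z = \<bar>\<rho>\<bar>" for v z
      using C(1) that sub by (intro dir_deriv_eq) (auto simp: C1_on_def)
    have cd: "continuous_on (norm -` {\<bar>\<rho>\<bar>}) (\<lambda>z. dir_deriv (p z) u z)"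
      if "continuous_on UNIV p" for p
    proof (subst continuous_on_cong[OF refl dir])
      have "continuous_on (norm -` {\<bar>\<rho>\<bar>}) p" "continuous_on (norm -` {\<bar>\<rho>\<bar>}) (dir_deriv 1 u)"
        "continuous_on (norm -` {\<bar>\<rho>\<bar>}) (dir_deriv \<i> u)"
        using C(1) that sub by (auto simp: C1_on_def elim: continuous_on_subset)
      then show "continuous_on (norm -` {\<bar>\<rho>\<bar>}) (\<lambda>z. Re (p z) *\<^sub>R dir_deriv 1 u z + Im (p z) *\<^sub>R dir_deriv \<i> u z)"
        by (intro continuous_intros)
    qed simp
    have "fourier (\<lambda>z. dir_deriv z u z) m \<rho> + of_int m * fourier u m \<rho> =
        fourier (\<lambda>z. dir_deriv z u z) m \<rho> + (- \<i>) * fourier (\<lambda>z. dir_deriv (\<i> * z) u z) m \<rho>"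
      unfolding fourier_angular_derivative[OF \<open>open ?S\<close> C(1) sub] by (simp flip: mult.assoc)
    also have "\<dots> = fourier (\<lambda>z. dir_deriv z u z + (- \<i>) * dir_deriv (\<i> * z) u z) m \<rho>"
      unfolding fourier_mult_left[symmetric]
      by (rule fourier_add[symmetric]) (intro continuous_intros cd)+
    also have "\<dots> = fourier (\<lambda>z. z * G z) m \<rho>"
    proof (rule fourier_cong)
      fix z :: complex
      assume "norm z = \<bar>\<rho>\<bar>"
      from dir[OF this, of z] dir[OF this, of "\<i> * z"]
      show "dir_deriv z u z + (- \<i>) * dir_deriv (\<i> * z) u z = z * G z"
        by (simp add: G_def complex_eq_iff algebra_simps)
    qed
    also have "\<dots> = A * \<rho> powi m"
      using \<rho> A[OF that] by (simp add: fourier_shift)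
    finally show ?thesis .
  qed
  then show ?thesis by blast
qed

lemma dir_deriv_cnj:
  assumes "f differentiable (at z)"
  shows "dir_deriv v (\<lambda>y. cnj (f y)) z = cnj (dir_deriv v f z)"
    and "(\<lambda>y. cnj (f y)) differentiable (at z)"
proof -
  have "((\<lambda>y. cnj (f y)) has_derivative (\<lambda>v. cnj (frechet_derivative f (at z) v))) (at z)"
    using assms by (auto intro!: derivative_intros simp: frechet_derivative_works)
  then show "dir_deriv v (\<lambda>y. cnj (f y)) z = cnj (dir_deriv v f z)"
    "(\<lambda>y. cnj (f y)) differentiable (at z)"
    by (auto simp: dir_deriv_eqI differentiable_def) (simp add: dir_deriv_def)
qed

lemma C1_on_cnj:
  assumes "C1_on S f"
  shows "C1_on S (\<lambda>y. cnj (f y))"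
proof -
  have "continuous_on S (dir_deriv v (\<lambda>y. cnj (f y)))" if "continuous_on S (dir_deriv v f)" for v
    using that assms dir_deriv_cnj(1)[of f _ v]
    by (subst continuous_on_cong[OF refl, of S _ "\<lambda>z. cnj (dir_deriv v f z)"])
      (auto intro!: continuous_intros simp: C1_on_def)
  then show ?thesis
    using assms dir_deriv_cnj(2) unfolding C1_on_def by auto
qed

lemma C2_on_cnj:
  assumes "open S" "C2_on S u"
  shows "C2_on S (\<lambda>y. cnj (u y))"
proof -
  have "C1_on S (dir_deriv v (\<lambda>y. cnj (u y)))" if "C1_on S (dir_deriv v u)" for v
  proof (rule C1_on_cong_open[OF assms(1) _ C1_on_cnj[OF that]])
    show "cnj (dir_deriv v u y) = dir_deriv v (\<lambda>y. cnj (u y)) y" if "y \<in> S" for y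
      using assms that by (simp add: dir_deriv_cnj C2_on_def C1_on_def)
  qed
  then show ?thesis
    using assms C1_on_cnj by (auto simp: C2_on_def)
qed

lemma laplacian_cnj:
  assumes "open S" "C2_on S u" "z \<in> S"
  shows "laplacian (\<lambda>y. cnj (u y)) z = cnj (laplacian u z)"
proof -
  have "dir_deriv v (dir_deriv v (\<lambda>y. cnj (u y))) z = cnj (dir_deriv v (dir_deriv v u) z)"
    if "C1_on S (dir_deriv v u)" for v
  proof -
    have "dir_deriv v (dir_deriv v (\<lambda>y. cnj (u y))) z = dir_deriv v (\<lambda>y. cnj (dir_deriv v u y)) z"
      using assms by (intro dir_deriv_cong_open[of S]) (auto simp: dir_deriv_cnj C2_on_def C1_on_def)
    then show ?thesis
      using that assms(3) by (simp add: dir_deriv_cnj C1_on_def)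
  qed
  then show ?thesis
    using assms(2) by (simp add: laplacian_def C2_on_def)
qed

text \<open>Conjugation reverses frequencies, so the second combination is the first one for
  \<open>cnj u\<close> at \<open>- m\<close>. For \<open>m = 0\<close> both say that the flux
  through concentric circles is constant, which \<open>exterior_fourier_zero\<close> uses.\<close>

lemma harmonic_fourier_parts:
  assumes I: "open I" "convex I" "I \<subseteq> {0<..}" and u: "C2_on (norm -` I) u"
    and harm: "\<And>z. norm z \<in> I \<Longrightarrow> laplacian u z = 0"
  obtains A B :: complex where
    "\<And>\<rho>. \<rho> \<in> I \<Longrightarrow> fourier (\<lambda>z. dir_deriv z u z) m \<rho> + of_int m * fourier u m \<rho> = A * \<rho> powi m"
    "\<And>\<rho>. \<rho> \<in> I \<Longrightarrow> fourier (\<lambda>z. dir_deriv z u z) m \<rho> - of_int m * fourier u m \<rho> = B * \<rho> powi (- m)"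
proof -
  let ?S = "norm -` I :: complex set"
  have "open ?S"
    using \<open>open I\<close> by (intro open_vimage continuous_intros)
  obtain A :: complex where A: "\<And>\<rho>. \<rho> \<in> I \<Longrightarrow>
      fourier (\<lambda>z. dir_deriv z u z) m \<rho> + of_int m * fourier u m \<rho> = A * \<rho> powi m"
    using harmonic_fourier_holomorphic_part[OF assms] by blast
  obtain B :: complex where B: "\<And>\<rho>. \<rho> \<in> I \<Longrightarrow>
      fourier (\<lambda>z. dir_deriv z (\<lambda>y. cnj (u y)) z) (- m) \<rho> + of_int (- m) * fourier (\<lambda>y. cnj (u y)) (- m) \<rho> = B * \<rho> powi (- m)"
    using harmonic_fourier_holomorphic_part[OF I C2_on_cnj[OF \<open>open ?S\<close> u], of "- m"]
      laplacian_cnj[OF \<open>open ?S\<close> u] harm by auto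
  have "fourier (\<lambda>z. dir_deriv z u z) m \<rho> - of_int m * fourier u m \<rho> = cnj B * \<rho> powi (- m)" if "\<rho> \<in> I" for \<rho>
  proof -
    have "fourier (\<lambda>z. dir_deriv z (\<lambda>y. cnj (u y)) z) (- m) \<rho> = fourier (\<lambda>z. cnj (dir_deriv z u z)) (- m) \<rho>"
      using u that I by (intro fourier_cong dir_deriv_cnj) (auto simp: C2_on_def C1_on_def)
    from arg_cong[OF B[OF that, unfolded this fourier_cnj], of cnj] show ?thesis
      by simp
  qed
  with A that show ?thesis by blast
qed

text \<open>The two combinations are solved for the coefficient and its radial derivative. This
  divides by m; frequency 0 would carry a logarithm in place of the negative power.\<close>

lemma harmonic_fourier:
  assumes I: "open I" "convex I" "I \<subseteq> {0<..}" and u: "C2_on (norm -` I) u"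
    and harm: "\<And>z. norm z \<in> I \<Longrightarrow> laplacian u z = 0" and "m \<noteq> 0"
  obtains \<alpha> \<beta> :: complex where
    "\<And>\<rho>. \<rho> \<in> I \<Longrightarrow> fourier u m \<rho> = \<alpha> * \<rho> ^ nat \<bar>m\<bar> + \<beta> / \<rho> ^ nat \<bar>m\<bar>"
    "\<And>\<rho>. \<rho> \<in> I \<Longrightarrow> fourier (\<lambda>z. dir_deriv z u z) m \<rho> = of_int \<bar>m\<bar> * (\<alpha> * \<rho> ^ nat \<bar>m\<bar> - \<beta> / \<rho> ^ nat \<bar>m\<bar>)"
proof -
  \<comment> \<open>Passing to |m| assigns \<alpha> to the growing and \<beta> to the decaying power
    for both signs of m; for negative m the two combinations trade places.\<close>
  define s :: int where "s = \<bar>m\<bar>"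
  obtain A B :: complex where
    AB: "\<And>\<rho>. \<rho> \<in> I \<Longrightarrow> fourier (\<lambda>z. dir_deriv z u z) m \<rho> + of_int s * fourier u m \<rho> = A * \<rho> powi s"
    "\<And>\<rho>. \<rho> \<in> I \<Longrightarrow> fourier (\<lambda>z. dir_deriv z u z) m \<rho> - of_int s * fourier u m \<rho> = B * \<rho> powi (- s)"
  proof -
    from harmonic_fourier_parts[OF assms(1-5), of m] obtain A B :: complex where
      AB: "\<And>\<rho>. \<rho> \<in> I \<Longrightarrow> fourier (\<lambda>z. dir_deriv z u z) m \<rho> + of_int m * fourier u m \<rho> = A * \<rho> powi m"
      "\<And>\<rho>. \<rho> \<in> I \<Longrightarrow> fourier (\<lambda>z. dir_deriv z u z) m \<rho> - of_int m * fourier u m \<rho> = B * \<rho> powi (- m)"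
      by blast
    show thesis
    proof (cases "m > 0")
      case True
      then have "s = m" by (simp add: s_def)
      with that[of A B] AB show ?thesis by simp
    next
      case False
      then have "s = - m" by (simp add: s_def)
      with that[of B A] AB show ?thesis by simp
    qed
  qed
  have pw: "z powi s = z ^ nat s" for z :: complex
    by (simp add: s_def power_int_def)
  have "s \<noteq> 0"
    using \<open>m \<noteq> 0\<close> by (simp add: s_def)
  show ?thesis
  proof (rule that[of "A / (2 * of_int s)" "- B / (2 * of_int s)"])
    fix \<rho> assume "\<rho> \<in> I"
    define f c X Y where "f = fourier (\<lambda>z. dir_deriv z u z) m \<rho>" and "c = fourier u m \<rho>"
      and "X = A * \<rho> ^ nat s" and "Y = B / \<rho> ^ nat s"
    have "f + of_int s * c = X"
      using AB(1)[OF \<open>\<rho> \<in> I\<close>] pw[of \<rho>] by (simp add: f_def c_def X_def)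
    moreover have "f - of_int s * c = Y"
      using AB(2)[OF \<open>\<rho> \<in> I\<close>] pw[of \<rho>]
      by (simp add: f_def c_def Y_def divide_inverse power_int_minus)
    ultimately have "c = (X - Y) / (2 * of_int s)" "f = (X + Y) / 2"
      using \<open>s \<noteq> 0\<close> by (auto simp: field_simps)
    moreover have "A / (2 * of_int s) * \<rho> ^ nat s = X / (2 * of_int s)"
      "- B / (2 * of_int s) / \<rho> ^ nat s = - (Y / (2 * of_int s))"
      by (simp_all add: X_def Y_def mult.commute)
    moreover have "of_int s * (X / (2 * of_int s) - - (Y / (2 * of_int s))) = (X + Y) / 2"
      using \<open>s \<noteq> 0\<close> by (simp add: field_simps)
    ultimately show "fourier u m \<rho> = A / (2 * of_int s) * \<rho> ^ nat \<bar>m\<bar> + - B / (2 * of_int s) / \<rho> ^ nat \<bar>m\<bar>"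
      "fourier (\<lambda>z. dir_deriv z u z) m \<rho> =
        of_int \<bar>m\<bar> * (A / (2 * of_int s) * \<rho> ^ nat \<bar>m\<bar> - - B / (2 * of_int s) / \<rho> ^ nat \<bar>m\<bar>)"
      unfolding s_def[symmetric] f_def[symmetric] c_def[symmetric]
      by (simp_all only:) (simp add: diff_divide_distrib)
  qed
qed

section \<open>Transmission conditions across concentric interfaces\<close>

text \<open>A bound on the values in \<open>A\<close> near x passes to a point y of \<open>B\<close>
  outside \<open>A\<close>, because \<open>f y\<close> is itself a limit of such values; the closed
  ball of radius e / 2 leaves room for the strict inequality.\<close>

lemma continuous_on_from_dense:
  fixes f :: "'a::metric_space \<Rightarrow> 'b::metric_space"
  assumes "B \<subseteq> closure A" and lim: "\<And>x. x \<in> B \<Longrightarrow> (f \<longlongrightarrow> f x) (at x within A)"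
  shows "continuous_on B f"
  unfolding continuous_on_def
proof (intro ballI tendstoI)
  fix x and e :: real
  assume x: "x \<in> B" and "e > 0"
  then have "\<forall>\<^sub>F y in at x within A. dist (f y) (f x) < e / 2"
    by (intro tendstoD lim) auto
  then obtain d where "d > 0" and d: "\<forall>y\<in>A. y \<noteq> x \<and> dist y x < d \<longrightarrow> dist (f y) (f x) < e / 2"
    unfolding eventually_at by blast
  then have d: "dist (f y) (f x) < e / 2" if "y \<in> A" "dist y x < d" for y
    using that \<open>e > 0\<close> by (cases "y = x") auto
  have "dist (f y) (f x) < e" if y: "y \<in> B" "dist y x < d" for y
  proof (cases "y \<in> A")
    case True
    then show ?thesis
      using d[of y] that \<open>e > 0\<close> by auto
  next
    case False
    then have "at y within A \<noteq> bot"
      using y assms(1) by (auto simp: trivial_limit_within closure_def)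
    moreover have "\<forall>\<^sub>F z in at y within A. f z \<in> cball (f x) (e / 2)"
    proof -
      have "\<forall>\<^sub>F z in at y within A. z \<in> ball x d"
        unfolding eventually_at_topological using y by (intro exI[of _ "ball x d"]) (auto simp: dist_commute)
      moreover have "\<forall>\<^sub>F z in at y within A. z \<in> A"
        by (simp add: eventually_at_filter)
      ultimately show ?thesis
        by eventually_elim (use d in \<open>auto simp: dist_commute less_imp_le\<close>)
    qed
    ultimately have "f y \<in> cball (f x) (e / 2)"
      using lim[OF y(1)] by (intro Lim_in_closed_set[of "cball (f x) (e / 2)"]) auto
    then show ?thesis
      using \<open>e > 0\<close> by (auto simp: dist_commute)
  qed
  then show "\<forall>\<^sub>F y in at x within B. dist (f y) (f x) < e"
    using \<open>d > 0\<close> by (auto simp: eventually_at)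
qed

text \<open>The transmission condition gives a limit at each boundary point separately, while the
  coefficient needs the whole circle at once. Since each limit is taken within the full annulus and
  not along a ray, the extension \<open>F'\<close> by boundary values is continuous, and
  \<open>continuous_on_fourier\<close> applies to it.\<close>

lemma fourier_boundary_limit:
  fixes F g :: "complex \<Rightarrow> complex"
  assumes I: "I \<subseteq> {0<..}" and F: "continuous_on (norm -` I) F"
    and \<rho>: "\<rho> \<in> closure I - I" "\<rho> > 0"
    and g: "\<And>x. norm x = \<rho> \<Longrightarrow> (F \<longlongrightarrow> g x) (at x within norm -` I)"
  shows "(fourier F m \<longlongrightarrow> fourier g m \<rho>) (at \<rho> within I)"
proof -
  define F' where "F' = (\<lambda>x. if norm x \<in> I then F x else g x)"
  have "continuous_on (norm -` insert \<rho> I) F'"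
  proof (rule continuous_on_from_dense)
    show "norm -` insert \<rho> I \<subseteq> closure (norm -` I :: complex set)"
    proof
      fix x :: complex
      assume "x \<in> norm -` insert \<rho> I"
      then have "norm x \<in> closure I"
        using \<rho> closure_subset[of I] by auto
      \<comment> \<open>Every point of the circle is approached along its own ray.\<close>
      have "(\<lambda>s. rcis s (Arg x)) ` closure I \<subseteq> closure (norm -` I)"
      proof (rule image_closure_subset)
        show "(\<lambda>s. rcis s (Arg x)) ` I \<subseteq> closure (norm -` I)"
          using I closure_subset[of "norm -` I :: complex set"] by force
      qed (auto intro!: continuous_intros)
      then show "x \<in> closure (norm -` I)"
        using \<open>norm x \<in> closure I\<close> rcis_cmod_Arg[of x] by (metis image_subset_iff)
    qed
    fix x :: complex
    assume x: "x \<in> norm -` insert \<rho> I"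
    have "(F \<longlongrightarrow> F' x) (at x within norm -` I)"
    proof (cases "norm x \<in> I")
      case True
      then show ?thesis
        using F by (simp add: F'_def continuous_on_def)
    next
      case False
      then show ?thesis
        using x g by (simp add: F'_def)
    qed
    then show "(F' \<longlongrightarrow> F' x) (at x within norm -` I)"
      by (rule tendsto_cong[THEN iffD1, rotated]) (auto simp: F'_def eventually_at_filter)
  qed
  then have "continuous_on (insert \<rho> I) (fourier F' m)"
    using I \<rho>(2) by (intro continuous_on_fourier) auto
  then have "(fourier F' m \<longlongrightarrow> fourier F' m \<rho>) (at \<rho> within I)"
    by (auto simp: continuous_on_def intro: tendsto_within_subset)
  moreover have "fourier F' m \<rho> = fourier g m \<rho>"
    using \<rho> by (intro fourier_cong) (auto simp: F'_def)
  moreover have "\<forall>\<^sub>F s in at \<rho> within I. fourier F' m s = fourier F m s"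
  proof -
    have "fourier F' m s = fourier F m s" if "s \<in> I" for s
      using that I by (intro fourier_cong) (auto simp: F'_def)
    then show ?thesis
      by (auto simp: eventually_at_filter)
  qed
  ultimately show ?thesis
    using tendsto_cong by force
qed

section \<open>Geometry of the layers and of their open annuli\<close>

locale concentric_layers =
  fixes N :: nat and r :: "nat \<Rightarrow> real"
  assumes N_pos: "N \<ge> 1" and r_anti: "strict_antimono_on {1..N} r" and r_N_pos: "r N > 0"
begin

lemma r_less: "1 \<le> j \<Longrightarrow> j < k \<Longrightarrow> k \<le> N \<Longrightarrow> r k < r j"
  using r_anti by (auto simp: monotone_on_def)

lemma r_le: "1 \<le> j \<Longrightarrow> j \<le> k \<Longrightarrow> k \<le> N \<Longrightarrow> r k \<le> r j"
  using r_less[of j k] by (cases "j = k") auto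

lemma r_pos: "1 \<le> k \<Longrightarrow> k \<le> N \<Longrightarrow> r k > 0"
  using r_le[of k N] r_N_pos by simp

text \<open>The expansions live on open annuli: interfaces are removed, the core loses its centre,
  where negative powers are singular, and the exterior has no outer bound, \<open>r 0\<close> being
  arbitrary.\<close>

definition radii :: "nat \<Rightarrow> real set" where
  "radii k = {\<rho>. (if k < N then r (Suc k) else 0) < \<rho> \<and> (k = 0 \<or> \<rho> < r k)}"

lemma radii_eq:
  "radii k = {(if k < N then r (Suc k) else 0)<..} \<inter> (if k = 0 then UNIV else {..<r k})"
  by (auto simp: radii_def)

lemma open_radii: "open (radii k)"
  unfolding radii_eq by (intro open_Int) auto

lemma convex_radii: "convex (radii k)"
  unfolding radii_eq by (intro convex_Int) auto

lemma radii_pos: "radii k \<subseteq> {0<..}"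
  using r_pos[of "Suc k"] by (auto simp: radii_def split: if_splits)

lemma open_annulus: "open (norm -` radii k :: complex set)"
  by (intro open_vimage open_radii continuous_intros)

lemma annulus_subset_layer:
  assumes "k \<le> N"
  shows "norm -` radii k \<subseteq> interior (layer N r k)"
proof (rule interior_maximal[OF _ open_annulus])
  show "norm -` radii k \<subseteq> layer N r k"
    using assms N_pos by (cases "k = N") (auto simp: radii_def layer_def)
qed

text \<open>This disjointness collapses the sum in \<open>conductivity\<close> to a single
  term.\<close>

lemma layer_unique:
  assumes "norm x \<in> radii k" "k \<le> N" "x \<in> layer N r j" "j \<le> N"
  shows "j = k"
proof (rule ccontr)
  assume "j \<noteq> k"
  then consider "j < k" | "k < j" by linarith
  then show False
  proof cases
    case 1
    then have "norm x < r k" "r (Suc j) < norm x" "r k \<le> r (Suc j)"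
      using assms r_le[of "Suc j" k] by (auto simp: radii_def layer_def split: if_splits)
    then show False by simp
  next
    case 2
    then have "norm x > r (Suc k)" "norm x \<le> r j" "r j \<le> r (Suc k)"
      using assms r_le[of "Suc k" j] by (auto simp: radii_def layer_def split: if_splits)
    then show False by simp
  qed
qed

lemma conductivity_annulus:
  assumes "norm x \<in> radii k" "k \<le> N"
  shows "conductivity N r \<sigma> x = \<sigma> k"
proof -
  have "x \<in> layer N r k"
    using annulus_subset_layer[OF assms(2)] interior_subset assms by blast
  then have "\<sigma> j * indicat_real (layer N r j) x = (if j = k then \<sigma> k else 0)" if "j \<in> {0..N}" for j
  proof (cases "j = k")
    case False
    then have "x \<notin> layer N r j"
      using layer_unique[OF assms] that by auto
    with False show ?thesis by simp
  qed simp
  then have "conductivity N r \<sigma> x = (\<Sum>j=0..N. if j = k then \<sigma> k else 0)"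
    unfolding conductivity_def by (intro sum.cong) auto
  then show ?thesis
    using assms(2) by simp
qed

lemma interface_limit_point:
  assumes "k \<in> {1..N}" "j = k \<or> Suc j = k"
  shows "at (r k) within radii j \<noteq> bot" "r k \<in> closure (radii j) - radii j"
proof -
  have "r k islimpt radii j"
  proof (cases "j = k")
    case True
    define a where "a = (if k < N then r (Suc k) else 0)"
    have "a < r k"
      using assms r_less[of k "Suc k"] r_pos[of k] by (auto simp: a_def)
    then have "r k islimpt {a<..<r k}"
      by (simp add: islimpt_greaterThanLessThan2)
    then show ?thesis
      by (rule islimpt_subset) (use True assms in \<open>auto simp: radii_def a_def\<close>)
  next
    case False
    \<comment> \<open>For \<open>k = 1\<close> the outer neighbour is the unbounded exterior, so any
      radius beyond \<open>r 1\<close> will do.\<close>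
    define b where "b = (if k = 1 then r k + 1 else r j)"
    have "r k < b"
      using False assms r_less[of j k] by (auto simp: b_def)
    then have "r k islimpt {r k<..<b}"
      by (simp add: islimpt_greaterThanLessThan1)
    then show ?thesis
      by (rule islimpt_subset) (use False assms in \<open>auto simp: radii_def b_def split: if_splits\<close>)
  qed
  moreover have "r k \<notin> radii j"
    using assms by (auto simp: radii_def)
  ultimately show "at (r k) within radii j \<noteq> bot" "r k \<in> closure (radii j) - radii j"
    by (auto simp: trivial_limit_within closure_def)
qed

end

section \<open>Fourier modes of a transmission solution inside the layers\<close>

locale transmission_solution = concentric_layers +
  fixes \<sigma> :: "nat \<Rightarrow> real" and H u :: "complex \<Rightarrow> complex"
  assumes \<sigma>_pos: "\<And>k. k \<le> N \<Longrightarrow> \<sigma> k > 0"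
    and H_cont: "continuous_on UNIV H"
    and solution: "conductivity_solution N r \<sigma> H u"
begin

lemma u_C2: "k \<le> N \<Longrightarrow> C2_on (norm -` radii k) u"
  using solution annulus_subset_layer unfolding conductivity_solution_def by (meson C2_on_subset)

lemma u_cont: "continuous_on UNIV u"
  using solution by (simp add: conductivity_solution_def)

lemma u_differentiable: "k \<le> N \<Longrightarrow> norm z \<in> radii k \<Longrightarrow> u differentiable (at z)"
  using u_C2[of k] by (auto simp: C2_on_def C1_on_def)

lemma u_harmonic:
  assumes k: "k \<le> N" and z: "norm z \<in> radii k"
  shows "laplacian u z = 0"
proof -
  have "dir_deriv v (\<lambda>y. conductivity N r \<sigma> y *\<^sub>R dir_deriv v u y) z = \<sigma> k *\<^sub>R dir_deriv v (dir_deriv v u) z"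
    if "C1_on (norm -` radii k) (dir_deriv v u)" for v
  proof -
    have "dir_deriv v (\<lambda>y. conductivity N r \<sigma> y *\<^sub>R dir_deriv v u y) z = dir_deriv v (\<lambda>y. \<sigma> k *\<^sub>R dir_deriv v u y) z"
      using z k by (intro dir_deriv_cong_open[OF open_annulus[of k]]) (auto simp: conductivity_annulus)
    then show ?thesis
      using that z by (simp add: dir_deriv_scaleR C1_on_def)
  qed
  then have "div_grad (conductivity N r \<sigma>) u z = \<sigma> k *\<^sub>R laplacian u z"
    using u_C2[OF k] by (simp add: div_grad_def laplacian_def C2_on_def scaleR_add_right)
  moreover have "div_grad (conductivity N r \<sigma>) u z = 0"
    using solution k z annulus_subset_layer[OF k] by (auto simp: conductivity_solution_def)
  ultimately show ?thesis
    using \<sigma>_pos[OF k] by simp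
qed

lemma flux_annulus:
  assumes "k \<le> N" "norm z \<in> radii k"
  shows "flux (conductivity N r \<sigma>) u z = of_real (\<sigma> k / norm z) * dir_deriv z u z"
proof -
  have "norm z > 0"
    using assms radii_pos[of k] by auto
  moreover have "dir_deriv (sgn z) u z = dir_deriv z u z /\<^sub>R norm z"
    using dir_deriv_eq[OF u_differentiable[OF assms], of "sgn z"] dir_deriv_eq[OF u_differentiable[OF assms], of z]
    by (simp add: sgn_div_norm scaleR_add_right divide_inverse)
  ultimately show ?thesis
    using conductivity_annulus[OF assms(2,1), of \<sigma>]
    by (simp add: flux_def scaleR_conv_of_real divide_inverse)
qed

lemma fourier_flux:
  assumes "k \<le> N" "\<rho> \<in> radii k"
  shows "fourier (flux (conductivity N r \<sigma>) u) m \<rho> = of_real (\<sigma> k / \<rho>) * fourier (\<lambda>z. dir_deriv z u z) m \<rho>"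
proof -
  have "\<rho> > 0"
    using assms radii_pos by auto
  then show ?thesis
    unfolding fourier_mult_left[symmetric]
    using assms by (intro fourier_cong) (auto simp: flux_annulus)
qed

lemma continuous_on_radial:
  assumes "k \<le> N"
  shows "continuous_on (norm -` radii k) (\<lambda>z. dir_deriv z u z)"
proof (rule continuous_on_eq)
  show "Re z *\<^sub>R dir_deriv 1 u z + Im z *\<^sub>R dir_deriv \<i> u z = dir_deriv z u z"
    if "z \<in> norm -` radii k" for z
    using dir_deriv_eq[OF u_differentiable[OF assms], of z z] that by simp
  show "continuous_on (norm -` radii k) (\<lambda>z. Re z *\<^sub>R dir_deriv 1 u z + Im z *\<^sub>R dir_deriv \<i> u z)"
    using u_C2[OF assms] by (intro continuous_intros) (auto simp: C2_on_def C1_on_def)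
qed

lemma continuous_on_flux:
  assumes "k \<le> N"
  shows "continuous_on (norm -` radii k) (flux (conductivity N r \<sigma>) u)"
proof (rule continuous_on_eq)
  show "of_real (\<sigma> k / norm z) * dir_deriv z u z = flux (conductivity N r \<sigma>) u z"
    if "z \<in> norm -` radii k" for z
    using flux_annulus[OF assms] that by simp
  show "continuous_on (norm -` radii k) (\<lambda>z. of_real (\<sigma> k / norm z) * dir_deriv z u z)"
    using radii_pos[of k] by (intro continuous_intros continuous_on_radial assms) auto
qed

text \<open>One \<open>G\<close> serves both neighbours of the interface: this is continuity of the
  flux at the level of a single frequency.\<close>

lemma flux_fourier_limit:
  assumes k: "k \<in> {1..N}"
  obtains G where "\<And>j. j = k \<or> Suc j = k \<Longrightarrow>
    (fourier (flux (conductivity N r \<sigma>) u) m \<longlongrightarrow> G) (at (r k) within radii j)"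
proof -
  have "\<forall>x. \<exists>g. norm x = r k \<longrightarrow>
      (flux (conductivity N r \<sigma>) u \<longlongrightarrow> g) (at x within interior (layer N r k)) \<and>
      (flux (conductivity N r \<sigma>) u \<longlongrightarrow> g) (at x within interior (layer N r (k - 1)))"
    using solution k unfolding conductivity_solution_def by (metis mem_sphere_0)
  then obtain g where g: "\<And>x. norm x = r k \<Longrightarrow>
      (flux (conductivity N r \<sigma>) u \<longlongrightarrow> g x) (at x within interior (layer N r k)) \<and>
      (flux (conductivity N r \<sigma>) u \<longlongrightarrow> g x) (at x within interior (layer N r (k - 1)))"
    by metis
  have "(fourier (flux (conductivity N r \<sigma>) u) m \<longlongrightarrow> fourier g m (r k)) (at (r k) within radii j)"
    if j: "j = k \<or> Suc j = k" for j
  proof (rule fourier_boundary_limit[OF radii_pos _ interface_limit_point(2)[OF k j]])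
    show "continuous_on (norm -` radii j) (flux (conductivity N r \<sigma>) u)"
      using j k by (intro continuous_on_flux) auto
    show "(flux (conductivity N r \<sigma>) u \<longlongrightarrow> g x) (at x within norm -` radii j)" if "norm x = r k" for x
    proof -
      have "norm -` radii j \<subseteq> interior (layer N r j)"
        using j k by (intro annulus_subset_layer) auto
      moreover have "(flux (conductivity N r \<sigma>) u \<longlongrightarrow> g x) (at x within interior (layer N r j))"
        using g[OF that] j by auto
      ultimately show ?thesis
        by (rule tendsto_within_subset[rotated])
    qed
  qed (use k r_pos in auto)
  then show ?thesis
    using that by blast
qed

lemma u_fourier_limit:
  assumes k: "k \<in> {1..N}"
  shows "(fourier u m \<longlongrightarrow> fourier u m (r k)) (at (r k) within radii j)"
proof -
  have "continuous_on {0..} (fourier u m)"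
    by (rule continuous_on_fourier) (use u_cont continuous_on_subset in auto)
  moreover have "r k \<in> {0..}"
    using k r_pos[of k] by auto
  ultimately have "(fourier u m \<longlongrightarrow> fourier u m (r k)) (at (r k) within {0..})"
    unfolding continuous_on_def by blast
  then show ?thesis
    by (rule tendsto_within_subset) (use radii_pos[of j] in auto)
qed

text \<open>The interface equations come from uniqueness of limits: the expansions on either side of
  \<open>r (Suc k)\<close> converge to the same coefficient of u and to the same coefficient of the
  flux. In the core the negative power is excluded by continuity of u at the centre.\<close>

lemma modes:
  assumes "m \<noteq> 0" and n: "n = nat \<bar>m\<bar>"
  obtains \<alpha> \<beta> :: "nat \<Rightarrow> complex" where
    "\<And>k \<rho>. k \<le> N \<Longrightarrow> \<rho> \<in> radii k \<Longrightarrow> fourier u m \<rho> = \<alpha> k * \<rho> ^ n + \<beta> k / \<rho> ^ n"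
    "\<And>k. k < N \<Longrightarrow> \<alpha> (Suc k) * r (Suc k) ^ n + \<beta> (Suc k) / r (Suc k) ^ n = \<alpha> k * r (Suc k) ^ n + \<beta> k / r (Suc k) ^ n"
    "\<And>k. k < N \<Longrightarrow> \<sigma> (Suc k) * (\<alpha> (Suc k) * r (Suc k) ^ n - \<beta> (Suc k) / r (Suc k) ^ n) = \<sigma> k * (\<alpha> k * r (Suc k) ^ n - \<beta> k / r (Suc k) ^ n)"
    "\<beta> N = 0"
proof -
  \<comment> \<open>Packing both identities into one predicate on pairs makes a single choice over
    the layers yield the same \<alpha> and \<beta> for u and for its radial derivative.\<close>
  define Q where "Q k p \<longleftrightarrow> (\<forall>\<rho>\<in>radii k. fourier u m \<rho> = fst p * \<rho> ^ n + snd p / \<rho> ^ n \<and>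
      fourier (\<lambda>z. dir_deriv z u z) m \<rho> = of_int \<bar>m\<bar> * (fst p * \<rho> ^ n - snd p / \<rho> ^ n))"
    for k and p :: "complex \<times> complex"
  have "\<exists>p. Q k p" if k: "k \<le> N" for k
  proof -
    have harm: "laplacian u z = 0" if "norm z \<in> radii k" for z
      using u_harmonic[OF k that] .
    show ?thesis
    proof (rule harmonic_fourier[OF open_radii convex_radii radii_pos u_C2[OF k] harm \<open>m \<noteq> 0\<close>])
      fix \<alpha> \<beta> :: complex
      assume "\<And>\<rho>. \<rho> \<in> radii k \<Longrightarrow> fourier u m \<rho> = \<alpha> * \<rho> ^ nat \<bar>m\<bar> + \<beta> / \<rho> ^ nat \<bar>m\<bar>"
        "\<And>\<rho>. \<rho> \<in> radii k \<Longrightarrow> fourier (\<lambda>z. dir_deriv z u z) m \<rho> = of_int \<bar>m\<bar> * (\<alpha> * \<rho> ^ nat \<bar>m\<bar> - \<beta> / \<rho> ^ nat \<bar>m\<bar>)"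
      then show ?thesis
        by (intro exI[of _ "(\<alpha>, \<beta>)"]) (simp add: n Q_def)
    qed
  qed
  then obtain p where p: "\<And>k. k \<le> N \<Longrightarrow> Q k (p k)"
    by metis
  define \<alpha> \<beta> where "\<alpha> k = fst (p k)" and "\<beta> k = snd (p k)" for k
  have u: "fourier u m \<rho> = \<alpha> k * \<rho> ^ n + \<beta> k / \<rho> ^ n" and
    f: "fourier (\<lambda>z. dir_deriv z u z) m \<rho> = of_int \<bar>m\<bar> * (\<alpha> k * \<rho> ^ n - \<beta> k / \<rho> ^ n)"
    if "k \<le> N" "\<rho> \<in> radii k" for k \<rho>
    using p[OF that(1)] that(2) unfolding Q_def \<alpha>_def \<beta>_def by blast+
  have uk: "fourier u m (r k) = \<alpha> j * r k ^ n + \<beta> j / r k ^ n" if k: "k \<in> {1..N}" and j: "j = k \<or> Suc j = k" for j k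
  proof (rule tendsto_unique[OF interface_limit_point(1)[OF k j] u_fourier_limit[OF k]])
    have "((\<lambda>\<rho>. \<alpha> j * of_real (\<rho> ^ n) + \<beta> j / of_real (\<rho> ^ n)) \<longlongrightarrow> \<alpha> j * r k ^ n + \<beta> j / r k ^ n) (at (r k) within radii j)"
      using k r_pos[of k] by (intro tendsto_intros) auto
    then show "(fourier u m \<longlongrightarrow> \<alpha> j * r k ^ n + \<beta> j / r k ^ n) (at (r k) within radii j)"
      by (rule tendsto_cong[THEN iffD1, rotated]) (use u[of j] j k in \<open>auto simp: eventually_at_filter\<close>)
  qed
  have fk: "\<sigma> (Suc k) * (\<alpha> (Suc k) * r (Suc k) ^ n - \<beta> (Suc k) / r (Suc k) ^ n) = \<sigma> k * (\<alpha> k * r (Suc k) ^ n - \<beta> k / r (Suc k) ^ n)"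
    if "k < N" for k
  proof -
    have k: "Suc k \<in> {1..N}" using that by auto
    obtain G where G: "\<And>j. j = Suc k \<or> Suc j = Suc k \<Longrightarrow>
        (fourier (flux (conductivity N r \<sigma>) u) m \<longlongrightarrow> G) (at (r (Suc k)) within radii j)"
      using flux_fourier_limit[OF k] by blast
    have "G = of_real (\<sigma> j / r (Suc k)) * (of_int \<bar>m\<bar> * (\<alpha> j * r (Suc k) ^ n - \<beta> j / r (Suc k) ^ n))"
      if j: "j = Suc k \<or> Suc j = Suc k" for j
    proof (rule tendsto_unique[OF interface_limit_point(1)[OF k j] G[OF j]])
      have "((\<lambda>\<rho>. of_real (\<sigma> j / \<rho>) * (of_int \<bar>m\<bar> * (\<alpha> j * of_real (\<rho> ^ n) - \<beta> j / of_real (\<rho> ^ n)))) \<longlongrightarrow>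
          of_real (\<sigma> j / r (Suc k)) * (of_int \<bar>m\<bar> * (\<alpha> j * r (Suc k) ^ n - \<beta> j / r (Suc k) ^ n))) (at (r (Suc k)) within radii j)"
        using k r_pos[of "Suc k"] by (intro tendsto_intros) auto
      then show "(fourier (flux (conductivity N r \<sigma>) u) m \<longlongrightarrow>
          of_real (\<sigma> j / r (Suc k)) * (of_int \<bar>m\<bar> * (\<alpha> j * r (Suc k) ^ n - \<beta> j / r (Suc k) ^ n))) (at (r (Suc k)) within radii j)"
        by (rule tendsto_cong[THEN iffD1, rotated])
          (use fourier_flux[of j] f[of j] j k in \<open>auto simp: eventually_at_filter\<close>)
    qed
    \<comment> \<open>Both sides carry the nonzero factor |m| / \<open>r (Suc k)\<close>, which
      cancels.\<close>
    from this[of k] this[of "Suc k"] have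
      "(of_int \<bar>m\<bar> / of_real (r (Suc k))) * (\<sigma> (Suc k) * (\<alpha> (Suc k) * r (Suc k) ^ n - \<beta> (Suc k) / r (Suc k) ^ n)) =
       (of_int \<bar>m\<bar> / of_real (r (Suc k))) * (\<sigma> k * (\<alpha> k * r (Suc k) ^ n - \<beta> k / r (Suc k) ^ n))"
      by (simp add: mult_ac)
    moreover have "of_int \<bar>m\<bar> / complex_of_real (r (Suc k)) \<noteq> 0"
      using \<open>m \<noteq> 0\<close> r_pos[of "Suc k"] k by auto
    ultimately show ?thesis
      using mult_cancel_left by blast
  qed
  \<comment> \<open>The product below is constantly \<open>\<beta> N\<close> for small positive
    radii, while continuity of the coefficient at radius 0 and n > 0 send it to 0.\<close>
  have core: "\<beta> N = 0"
  proof (rule tendsto_unique)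
    have c: "continuous_on {0..} (fourier u m)"
      by (rule continuous_on_fourier) (use u_cont continuous_on_subset in auto)
    then have "(fourier u m \<longlongrightarrow> fourier u m 0) (at 0 within {0..})"
      unfolding continuous_on_def by auto
    then have "(fourier u m \<longlongrightarrow> fourier u m 0) (at_right 0)"
      by (rule tendsto_within_subset) auto
    then have "((\<lambda>\<rho>. (fourier u m \<rho> - \<alpha> N * of_real (\<rho> ^ n)) * of_real (\<rho> ^ n)) \<longlongrightarrow>
        (fourier u m 0 - \<alpha> N * of_real (0 ^ n)) * of_real (0 ^ n)) (at_right 0)"
      by (intro tendsto_intros)
    then have "((\<lambda>\<rho>. (fourier u m \<rho> - \<alpha> N * of_real (\<rho> ^ n)) * of_real (\<rho> ^ n)) \<longlongrightarrow> 0) (at_right 0)"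
      using assms by (simp add: power_0_left)
    moreover have "\<forall>\<^sub>F \<rho> in at_right 0. (fourier u m \<rho> - \<alpha> N * of_real (\<rho> ^ n)) * of_real (\<rho> ^ n) = \<beta> N"
    proof -
      have "\<forall>\<^sub>F \<rho> in at_right 0. \<rho> \<in> {0<..<r N}"
        using r_N_pos eventually_at_right_real by blast
      then show ?thesis
        by eventually_elim (use u[of N] N_pos in \<open>auto simp: radii_def field_simps\<close>)
    qed
    ultimately show "((\<lambda>_. \<beta> N) \<longlongrightarrow> 0) (at_right (0::real))"
      using tendsto_cong by fast
  qed auto
  have cont: "\<alpha> (Suc k) * r (Suc k) ^ n + \<beta> (Suc k) / r (Suc k) ^ n = \<alpha> k * r (Suc k) ^ n + \<beta> k / r (Suc k) ^ n"
    if "k < N" for k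
    using uk[of "Suc k" "Suc k"] uk[of "Suc k" k] that by auto
  show ?thesis
    by (rule that[OF _ cont fk core]) (simp add: u)
qed

end

section \<open>The exterior expansion\<close>

text \<open>\<open>A\<close> and \<open>B\<close> stand for \<alpha> \<rho>^n and \<beta> / \<rho>^n
  on one side of an interface, the primed letters for the other side. Eliminating \<open>B\<close>
  gives the first identity, the source of the contrast. The second holds because |A|^2 - |B|^2 is
  the real part of (A + B) cnj (A - B), potential times flux.\<close>

lemma flux_balance:
  fixes A B A' B' :: complex and s s' :: real
  assumes "A' + B' = A + B" "s' * (A' - B') = s * (A - B)"
  shows "(s' - s) * (B' - A) = (s' + s) * (A' - A)"
    and "s' * ((norm A')\<^sup>2 - (norm B')\<^sup>2) = s * ((norm A)\<^sup>2 - (norm B)\<^sup>2)"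
proof -
  have B: "B = A' + B' - A"
    using assms(1) by (simp add: algebra_simps)
  show "(s' - s) * (B' - A) = (s' + s) * (A' - A)"
    using assms(2) unfolding B by (simp add: algebra_simps)
  have power: "(norm a)\<^sup>2 - (norm b)\<^sup>2 = Re ((a + b) * cnj (a - b))" for a b :: complex
    unfolding cmod_power2 by (simp add: algebra_simps power2_eq_square)
  have "s' * ((norm A')\<^sup>2 - (norm B')\<^sup>2) = Re ((A' + B') * cnj (s' * (A' - B')))"
    unfolding power by (simp add: algebra_simps)
  also have "\<dots> = s * ((norm A)\<^sup>2 - (norm B)\<^sup>2)"
    unfolding power assms by (simp add: algebra_simps)
  finally show "s' * ((norm A')\<^sup>2 - (norm B')\<^sup>2) = s * ((norm A)\<^sup>2 - (norm B)\<^sup>2)" .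
qed

text \<open>Shaped after the three cases in the definition of \<open>gpm\<close>: on the diagonal,
  right of it and left of it.\<close>

lemma sum_split_at:
  fixes a b c :: "nat \<Rightarrow> 'a::comm_monoid_add"
  assumes "p < N"
  shows "(\<Sum>q<N. if p = q then a q else if p < q then b q else c q) =
    (\<Sum>q<p. c q) + (a p + (\<Sum>q=Suc p..<N. b q))"
proof -
  let ?f = "\<lambda>q. if p = q then a q else if p < q then b q else c q"
  have "sum ?f {..<N} = sum ?f {..<p} + sum ?f {p..<N}"
    using assms by (subst sum.union_disjoint[symmetric]) (auto intro!: sum.cong)
  also have "sum ?f {p..<N} = ?f p + sum ?f {Suc p..<N}"
    using assms by (rule sum.atLeast_Suc_lessThan)
  finally show ?thesis
    by (simp cong: sum.cong_simp)
qed

section \<open>A single mode: energy argument and polarization matrix\<close>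

context concentric_layers
begin

text \<open>With E(\<rho>) = |\<alpha>|^2 \<rho>^(2n) - |\<beta>|^2 / \<rho>^(2n) in each layer, \<sigma> E is continuous across the
  interfaces, E increases within every layer, and E is nonnegative in the core.\<close>

lemma sourceless_mode:
  fixes \<alpha> \<beta> :: "nat \<Rightarrow> complex" and \<sigma> :: "nat \<Rightarrow> real"
  assumes \<sigma>: "\<And>k. k \<le> N \<Longrightarrow> \<sigma> k > 0"
    and cont: "\<And>k. k < N \<Longrightarrow> \<alpha> (Suc k) * r (Suc k) ^ n + \<beta> (Suc k) / r (Suc k) ^ n = \<alpha> k * r (Suc k) ^ n + \<beta> k / r (Suc k) ^ n"
    and flux: "\<And>k. k < N \<Longrightarrow> \<sigma> (Suc k) * (\<alpha> (Suc k) * r (Suc k) ^ n - \<beta> (Suc k) / r (Suc k) ^ n) = \<sigma> k * (\<alpha> k * r (Suc k) ^ n - \<beta> k / r (Suc k) ^ n)"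
    and core: "\<beta> N = 0" and "\<alpha> 0 = 0"
  shows "\<beta> 0 = 0"
proof -
  define E :: "nat \<Rightarrow> real \<Rightarrow> real" where "E k x = (norm (\<alpha> k * x))\<^sup>2 - (norm (\<beta> k / x))\<^sup>2" for k and x :: real
  have mono: "E k x \<le> E k y" if "0 < x" "x \<le> y" for k x y
  proof -
    have "norm (\<alpha> k * x) \<le> norm (\<alpha> k * y)" "norm (\<beta> k / y) \<le> norm (\<beta> k / x)"
      using that by (auto simp: norm_mult norm_divide intro!: mult_left_mono divide_left_mono)
    then show ?thesis
      unfolding E_def by (intro diff_mono power_mono) auto
  qed
  \<comment> \<open>Downward induction from the core, with x in the role of \<rho>^n. The guard
    \<open>k < N\<close> drops the lower bound on x in the core, which has no inner
    interface.\<close>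
  have "\<forall>x>0. (0 < N \<longrightarrow> r (Suc 0) ^ n \<le> x) \<longrightarrow> 0 \<le> E 0 x"
  proof (rule inc_induct[of 0 N "\<lambda>k. \<forall>x>0. (k < N \<longrightarrow> r (Suc k) ^ n \<le> x) \<longrightarrow> 0 \<le> E k x"])
    show "\<forall>x>0. (N < N \<longrightarrow> r (Suc N) ^ n \<le> x) \<longrightarrow> 0 \<le> E N x"
      using core by (simp add: E_def)
    fix k
    assume k: "k < N" and IH: "\<forall>x>0. (Suc k < N \<longrightarrow> r (Suc (Suc k)) ^ n \<le> x) \<longrightarrow> 0 \<le> E (Suc k) x"
    define x where "x = r (Suc k) ^ n"
    have "x > 0"
      using k r_pos[of "Suc k"] by (simp add: x_def)
    moreover have "r (Suc (Suc k)) ^ n \<le> x" if "Suc k < N"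
      using that r_pos[of "Suc (Suc k)"] r_le[of "Suc k" "Suc (Suc k)"] by (auto simp: x_def intro!: power_mono)
    ultimately have "0 \<le> E (Suc k) x"
      using IH by blast
    moreover have "\<sigma> (Suc k) * E (Suc k) x = \<sigma> k * E k x"
      unfolding E_def by (rule flux_balance(2)) (use cont[OF k] flux[OF k] in \<open>simp_all add: x_def\<close>)
    ultimately have "0 \<le> E k x"
      using \<sigma>[of k] \<sigma>[of "Suc k"] k by (metis Suc_leI less_imp_le mult_nonneg_nonneg zero_le_mult_iff linorder_not_le)
    then show "\<forall>y>0. (k < N \<longrightarrow> r (Suc k) ^ n \<le> y) \<longrightarrow> 0 \<le> E k y"
      using mono[OF \<open>x > 0\<close>] k unfolding x_def by (meson order_trans)
  qed simp
  \<comment> \<open>With \<open>\<alpha> 0 = 0\<close> this energy is minus a square, so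
    nonnegativity leaves only \<open>\<beta> 0 = 0\<close>.\<close>
  then have "0 \<le> E 0 (r 1 ^ n)"
    using N_pos r_pos[of 1] by auto
  then show ?thesis
    using \<open>\<alpha> 0 = 0\<close> r_pos[of 1] N_pos by (simp add: E_def)
qed

text \<open>Continuity of u ties the jumps of \<alpha> and \<beta> at each interface
  (\<open>jump\<close>). The interfaces outside the p-th one lead from \<open>\<alpha> 0\<close> to
  \<open>\<alpha> p\<close> and give the entries -1; those inside it lead from
  \<open>\<beta> N = 0\<close> to \<open>\<beta> (Suc p)\<close> and give the quotients of radii.
  Flux continuity at the interface itself gives the diagonal.\<close>

lemma mode_matrix_equation:
  fixes \<alpha> \<beta> :: "nat \<Rightarrow> complex" and \<sigma> :: "nat \<Rightarrow> real"
  assumes \<sigma>: "\<And>k. k < N \<Longrightarrow> \<sigma> (Suc k) \<noteq> \<sigma> k"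
    and cont: "\<And>k. k < N \<Longrightarrow> \<alpha> (Suc k) * r (Suc k) ^ n + \<beta> (Suc k) / r (Suc k) ^ n = \<alpha> k * r (Suc k) ^ n + \<beta> k / r (Suc k) ^ n"
    and flux: "\<And>k. k < N \<Longrightarrow> \<sigma> (Suc k) * (\<alpha> (Suc k) * r (Suc k) ^ n - \<beta> (Suc k) / r (Suc k) ^ n) = \<sigma> k * (\<alpha> k * r (Suc k) ^ n - \<beta> k / r (Suc k) ^ n)"
    and core: "\<beta> N = 0"
  shows "p < N \<Longrightarrow> (\<Sum>q<N. of_real (gpm N r \<sigma> n $$ (p, q)) * (\<alpha> (Suc q) - \<alpha> q)) = \<alpha> 0"
    and "(\<Sum>q<N. of_real (r (Suc q) ^ (2 * n)) * (\<alpha> (Suc q) - \<alpha> q)) = \<beta> 0"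
proof -
  have jump: "of_real (r (Suc q) ^ (2 * n)) * (\<alpha> (Suc q) - \<alpha> q) = \<beta> q - \<beta> (Suc q)" if "q < N" for q
  proof -
    define X where "X = complex_of_real (r (Suc q) ^ n)"
    have "X \<noteq> 0"
      using that r_pos[of "Suc q"] by (simp add: X_def)
    have "X * X * (\<alpha> (Suc q) - \<alpha> q) = \<beta> q - \<beta> (Suc q)"
      using arg_cong[OF cont[OF that], of "\<lambda>t. X * t"] \<open>X \<noteq> 0\<close> unfolding X_def[symmetric]
      by (simp add: algebra_simps)
    moreover have "of_real (r (Suc q) ^ (2 * n)) = X * X"
      by (simp add: X_def mult_2 power_add)
    ultimately show ?thesis by simp
  qed
  have "(\<Sum>q<N. of_real (r (Suc q) ^ (2 * n)) * (\<alpha> (Suc q) - \<alpha> q)) = (\<Sum>q<N. \<beta> q - \<beta> (Suc q))"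
    by (intro sum.cong refl jump) auto
  then show "(\<Sum>q<N. of_real (r (Suc q) ^ (2 * n)) * (\<alpha> (Suc q) - \<alpha> q)) = \<beta> 0"
    by (simp add: sum_lessThan_telescope' core)
  assume p: "p < N"
  define x where "x = r (Suc p) ^ n"
  have "x \<noteq> 0"
    using p r_pos[of "Suc p"] by (simp add: x_def)
  have "(\<Sum>q<N. of_real (gpm N r \<sigma> n $$ (p, q)) * (\<alpha> (Suc q) - \<alpha> q)) =
      (\<Sum>q<N. if p = q then of_real (- 2 * contrast \<sigma> (q + 1)) * (\<alpha> (Suc q) - \<alpha> q)
        else if p < q then of_real ((r (q + 1) / r (p + 1)) ^ (2 * n)) * (\<alpha> (Suc q) - \<alpha> q)
        else \<alpha> q - \<alpha> (Suc q))"
    using p by (intro sum.cong) (auto simp: gpm_def)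
  also have "\<dots> = (\<Sum>q<p. \<alpha> q - \<alpha> (Suc q)) + (of_real (- 2 * contrast \<sigma> (p + 1)) * (\<alpha> (Suc p) - \<alpha> p) +
      (\<Sum>q=Suc p..<N. of_real ((r (q + 1) / r (p + 1)) ^ (2 * n)) * (\<alpha> (Suc q) - \<alpha> q)))"
    using p by (rule sum_split_at)
  also have "(\<Sum>q<p. \<alpha> q - \<alpha> (Suc q)) = \<alpha> 0 - \<alpha> p"
    by (rule sum_lessThan_telescope')
  also have "(\<Sum>q=Suc p..<N. of_real ((r (q + 1) / r (p + 1)) ^ (2 * n)) * (\<alpha> (Suc q) - \<alpha> q)) =
      (\<Sum>q=Suc p..<N. - (\<beta> (Suc q) - \<beta> q)) / of_real (x\<^sup>2)"
  proof -
    have "of_real ((r (q + 1) / r (p + 1)) ^ (2 * n)) * (\<alpha> (Suc q) - \<alpha> q) = - (\<beta> (Suc q) - \<beta> q) / of_real (x\<^sup>2)"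
      if "q \<in> {Suc p..<N}" for q
    proof -
      have "x\<^sup>2 = r (Suc p) ^ (2 * n)"
        by (simp add: x_def power_mult[symmetric] mult.commute)
      then show ?thesis
        using jump[of q] that by (simp add: power_divide)
    qed
    then show ?thesis
      by (simp add: sum_divide_distrib)
  qed
  also have "(\<Sum>q=Suc p..<N. - (\<beta> (Suc q) - \<beta> q)) = \<beta> (Suc p)"
    using p core by (simp only: sum_negf sum_Suc_diff') simp
  \<comment> \<open>The first identity of \<open>flux_balance\<close>, divided by x and by the
    difference of the conductivities; the contrast is half the resulting quotient.\<close>
  also have "of_real (- 2 * contrast \<sigma> (p + 1)) * (\<alpha> (Suc p) - \<alpha> p) = \<alpha> p - \<beta> (Suc p) / of_real (x\<^sup>2)"
  proof -
    have "(of_real (\<sigma> (Suc p)) - of_real (\<sigma> p)) * (\<beta> (Suc p) / x - \<alpha> p * x) =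
        (of_real (\<sigma> (Suc p)) + of_real (\<sigma> p)) * (\<alpha> (Suc p) * x - \<alpha> p * x)"
      using flux_balance(1)[of "\<alpha> (Suc p) * x" "\<beta> (Suc p) / x" "\<alpha> p * x" "\<beta> p / x" "\<sigma> (Suc p)" "\<sigma> p"]
        cont[OF p] flux[OF p] by (simp add: x_def)
    moreover have "\<beta> (Suc p) / x - \<alpha> p * x = of_real x * (\<beta> (Suc p) / of_real (x\<^sup>2) - \<alpha> p)"
      using \<open>x \<noteq> 0\<close> by (simp add: field_simps power2_eq_square)
    moreover have "\<alpha> (Suc p) * x - \<alpha> p * x = of_real x * (\<alpha> (Suc p) - \<alpha> p)"
      by (simp add: algebra_simps)
    ultimately have "of_real x * ((of_real (\<sigma> (Suc p)) - of_real (\<sigma> p)) * (\<beta> (Suc p) / of_real (x\<^sup>2) - \<alpha> p)) =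
        of_real x * ((of_real (\<sigma> (Suc p)) + of_real (\<sigma> p)) * (\<alpha> (Suc p) - \<alpha> p))"
      by (simp only: mult.left_commute)
    then have "(of_real (\<sigma> (Suc p)) - of_real (\<sigma> p)) * (\<beta> (Suc p) / of_real (x\<^sup>2) - \<alpha> p) =
        (of_real (\<sigma> (Suc p)) + of_real (\<sigma> p)) * (\<alpha> (Suc p) - \<alpha> p)"
      using \<open>x \<noteq> 0\<close> by (simp only: mult_cancel_left) simp
    moreover have "of_real (\<sigma> (Suc p)) - complex_of_real (\<sigma> p) \<noteq> 0"
      using \<sigma>[OF p] by simp
    ultimately have "\<beta> (Suc p) / of_real (x\<^sup>2) - \<alpha> p =
        (of_real (\<sigma> (Suc p)) + of_real (\<sigma> p)) / (of_real (\<sigma> (Suc p)) - of_real (\<sigma> p)) * (\<alpha> (Suc p) - \<alpha> p)"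
      by (simp add: nonzero_eq_divide_eq mult.commute)
    moreover have "complex_of_real (- 2 * contrast \<sigma> (p + 1)) =
        - ((of_real (\<sigma> (Suc p)) + of_real (\<sigma> p)) / (of_real (\<sigma> (Suc p)) - of_real (\<sigma> p)))"
    proof -
      have "- 2 * contrast \<sigma> (p + 1) = - ((\<sigma> (Suc p) + \<sigma> p) / (\<sigma> (Suc p) - \<sigma> p))"
        using \<sigma>[OF p] by (simp add: contrast_def divide_simps) (simp add: algebra_simps)?
      then show ?thesis by simp
    qed
    ultimately show ?thesis
      by (simp add: algebra_simps)
  qed
  finally show "(\<Sum>q<N. of_real (gpm N r \<sigma> n $$ (p, q)) * (\<alpha> (Suc q) - \<alpha> q)) = \<alpha> 0"
    by simp
qed

lemma radii_0: "radii 0 = {r 1<..}"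
  using N_pos by (auto simp: radii_def)

end

section \<open>The field outside the disk, one frequency at a time\<close>

context transmission_solution
begin

lemma fourier_decay: "((\<lambda>\<rho>. fourier u m \<rho> - fourier H m \<rho>) \<longlongrightarrow> 0) at_top"
proof -
  have "(\<lambda>x. norm (u x - H x)) \<in> O[at_infinity](\<lambda>x. 1 / norm x)"
    using solution by (simp add: conductivity_solution_def)
  then obtain C where "\<forall>\<^sub>F x in at_infinity. norm (norm (u x - H x)) \<le> C * norm (1 / norm x)"
    by (auto simp: bigo_def)
  then obtain R where R: "\<And>x. norm x \<ge> R \<Longrightarrow> norm (u x - H x) \<le> C / norm x"
    by (auto simp: eventually_at_infinity)
  have "norm (fourier u m \<rho> - fourier H m \<rho>) \<le> 2 * pi * (C / \<rho>)" if \<rho>: "\<rho> \<ge> max R 1" for \<rho>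
  proof -
    have c: "continuous_on (norm -` {\<bar>\<rho>\<bar>}) u" "continuous_on (norm -` {\<bar>\<rho>\<bar>}) H"
      using u_cont H_cont continuous_on_subset by blast+
    have "fourier u m \<rho> - fourier H m \<rho> = fourier (\<lambda>x. u x - H x) m \<rho>"
      by (rule fourier_diff[OF c, symmetric])
    then show ?thesis
      using norm_fourier_le[OF continuous_on_diff[OF c], of "C / \<rho>" m] R \<rho> by auto
  qed
  then have bound: "\<forall>\<^sub>F \<rho> in at_top. norm (fourier u m \<rho> - fourier H m \<rho>) \<le> 2 * pi * (C / \<rho>)"
    using eventually_ge_at_top[of "max R 1"] by (rule eventually_mono[rotated]) auto
  have "((\<lambda>\<rho>. 2 * pi * (C / \<rho>)) \<longlongrightarrow> 2 * pi * 0) at_top"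
    by (intro tendsto_intros tendsto_divide_0[OF tendsto_const] filterlim_at_top_imp_at_infinity filterlim_ident)
  then have "((\<lambda>\<rho>. 2 * pi * (C / \<rho>)) \<longlongrightarrow> 0) at_top"
    by simp
  then show ?thesis
    by (rule Lim_null_comparison[OF bound])
qed

text \<open>\<open>h\<close> is the incident and \<gamma> the scattered amplitude, \<open>d\<close>
  collects the jumps of \<alpha>. The decay condition identifies \<open>\<alpha> 0\<close> with
  \<open>h\<close>, and \<open>sourceless_mode\<close> settles the case of no incident
  field.\<close>

lemma exterior_fourier:
  fixes h :: complex
  assumes \<sigma>: "\<And>k. k < N \<Longrightarrow> \<sigma> (Suc k) \<noteq> \<sigma> k" and "m \<noteq> 0" and n: "n = nat \<bar>m\<bar>"
    and H: "\<And>\<rho>. \<rho> > 0 \<Longrightarrow> fourier H m \<rho> = h * \<rho> ^ n"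
  obtains d :: "nat \<Rightarrow> complex" and \<gamma> :: complex where
    "\<And>\<rho>. \<rho> > r 1 \<Longrightarrow> fourier u m \<rho> = h * \<rho> ^ n + \<gamma> / \<rho> ^ n"
    "h = 0 \<Longrightarrow> \<gamma> = 0"
    "\<And>p. p < N \<Longrightarrow> (\<Sum>q<N. of_real (gpm N r \<sigma> n $$ (p, q)) * d q) = h"
    "(\<Sum>q<N. of_real (r (Suc q) ^ (2 * n)) * d q) = \<gamma>"
proof (rule modes[OF \<open>m \<noteq> 0\<close> n])
  fix \<alpha> \<beta> :: "nat \<Rightarrow> complex"
  assume u: "\<And>k \<rho>. k \<le> N \<Longrightarrow> \<rho> \<in> radii k \<Longrightarrow> fourier u m \<rho> = \<alpha> k * \<rho> ^ n + \<beta> k / \<rho> ^ n"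
    and cont: "\<And>k. k < N \<Longrightarrow> \<alpha> (Suc k) * r (Suc k) ^ n + \<beta> (Suc k) / r (Suc k) ^ n = \<alpha> k * r (Suc k) ^ n + \<beta> k / r (Suc k) ^ n"
    and flux: "\<And>k. k < N \<Longrightarrow> \<sigma> (Suc k) * (\<alpha> (Suc k) * r (Suc k) ^ n - \<beta> (Suc k) / r (Suc k) ^ n) = \<sigma> k * (\<alpha> k * r (Suc k) ^ n - \<beta> k / r (Suc k) ^ n)"
    and core: "\<beta> N = 0"
  have inv: "((\<lambda>\<rho>. complex_of_real (1 / \<rho> ^ n)) \<longlongrightarrow> 0) at_top"
  proof -
    have "((\<lambda>\<rho>. complex_of_real (inverse \<rho> ^ n)) \<longlongrightarrow> complex_of_real (0 ^ n)) at_top"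
      by (intro tendsto_intros tendsto_inverse_0_at_top filterlim_ident)
    then show ?thesis
      using assms(2) by (simp add: n power_0_left divide_inverse power_inverse)
  qed
  \<comment> \<open>Dividing the coefficient of u - H by \<rho>^n and subtracting the \<beta> term
    leaves the constant \<open>\<alpha> 0 - h\<close>, whose limit is 0.\<close>
  have "\<alpha> 0 = h"
  proof -
    have "((\<lambda>\<rho>. (fourier u m \<rho> - fourier H m \<rho>) * (1 / \<rho> ^ n) - \<beta> 0 * (1 / \<rho> ^ n) * (1 / \<rho> ^ n)) \<longlongrightarrow> 0 * 0 - \<beta> 0 * 0 * 0) at_top"
      by (intro tendsto_intros fourier_decay inv)
    moreover have "\<forall>\<^sub>F \<rho> in at_top. (fourier u m \<rho> - fourier H m \<rho>) * (1 / \<rho> ^ n) - \<beta> 0 * (1 / \<rho> ^ n) * (1 / \<rho> ^ n) = \<alpha> 0 - h"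
      using eventually_gt_at_top[of "r 1"]
    proof eventually_elim
      case (elim \<rho>)
      then have "\<rho> > 0"
        using r_pos[of 1] N_pos by simp
      then show ?case
        using u[of 0 \<rho>] H[of \<rho>] elim by (simp add: radii_0 field_simps)
    qed
    ultimately have "((\<lambda>\<rho>::real. \<alpha> 0 - h) \<longlongrightarrow> 0) at_top"
      using tendsto_cong by force
    then show ?thesis
      using tendsto_unique[OF trivial_limit_at_top_linorder tendsto_const] by force
  qed
  show thesis
  proof (rule that[of "\<beta> 0" "\<lambda>q. \<alpha> (Suc q) - \<alpha> q"])
    show "fourier u m \<rho> = h * \<rho> ^ n + \<beta> 0 / \<rho> ^ n" if "\<rho> > r 1" for \<rho>
      using u[of 0 \<rho>] that by (simp add: radii_0 \<open>\<alpha> 0 = h\<close>)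
    show "\<beta> 0 = 0" if "h = 0"
      using sourceless_mode[OF \<sigma>_pos cont flux core] that \<open>\<alpha> 0 = h\<close> by simp
    show "(\<Sum>q<N. of_real (gpm N r \<sigma> n $$ (p, q)) * (\<alpha> (Suc q) - \<alpha> q)) = h" if "p < N" for p
      using mode_matrix_equation(1)[OF \<sigma> cont flux core that] \<open>\<alpha> 0 = h\<close> by simp
    show "(\<Sum>q<N. of_real (r (Suc q) ^ (2 * n)) * (\<alpha> (Suc q) - \<alpha> q)) = \<beta> 0"
      by (rule mode_matrix_equation(2)[OF \<sigma> cont flux core])
  qed
qed

text \<open>Frequency 0 could contain a logarithm, whose strength in layer k is \<open>A k\<close>.
  Continuity of the flux makes \<open>\<sigma> k * A k\<close> the same in all layers, and it
  vanishes in the core, so no logarithm reaches the exterior; decay then kills the remaining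
  constant.\<close>

lemma exterior_fourier_zero:
  assumes H: "\<And>\<rho>. \<rho> > 0 \<Longrightarrow> fourier H 0 \<rho> = 0" and "\<rho> > r 1"
  shows "fourier u 0 \<rho> = 0"
proof -
  let ?f = "\<lambda>z. dir_deriv z u z"
  have "\<exists>A. \<forall>\<rho>\<in>radii k. fourier ?f 0 \<rho> = A" if k: "k \<le> N" for k
  proof -
    have harm: "laplacian u z = 0" if "norm z \<in> radii k" for z
      using u_harmonic[OF k that] .
    show ?thesis
      by (rule harmonic_fourier_parts[OF open_radii convex_radii radii_pos u_C2[OF k] harm, of 0]) auto
  qed
  then obtain A where A: "\<And>k \<rho>. k \<le> N \<Longrightarrow> \<rho> \<in> radii k \<Longrightarrow> fourier ?f 0 \<rho> = A k"
    by metis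
  have interface: "\<sigma> (Suc k) * A (Suc k) = \<sigma> k * A k" if "k < N" for k
  proof -
    have k: "Suc k \<in> {1..N}" using that by auto
    obtain G where G: "\<And>j. j = Suc k \<or> Suc j = Suc k \<Longrightarrow>
        (fourier (flux (conductivity N r \<sigma>) u) 0 \<longlongrightarrow> G) (at (r (Suc k)) within radii j)"
      using flux_fourier_limit[OF k] by blast
    have "G = of_real (\<sigma> j / r (Suc k)) * A j" if j: "j = Suc k \<or> Suc j = Suc k" for j
    proof (rule tendsto_unique[OF interface_limit_point(1)[OF k j] G[OF j]])
      have "((\<lambda>\<rho>. of_real (\<sigma> j / \<rho>) * A j) \<longlongrightarrow> of_real (\<sigma> j / r (Suc k)) * A j) (at (r (Suc k)) within radii j)"
        using k r_pos[of "Suc k"] by (intro tendsto_intros) auto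
      then show "(fourier (flux (conductivity N r \<sigma>) u) 0 \<longlongrightarrow> of_real (\<sigma> j / r (Suc k)) * A j) (at (r (Suc k)) within radii j)"
        by (rule tendsto_cong[THEN iffD1, rotated])
          (use fourier_flux[of j] A[of j] j k in \<open>auto simp: eventually_at_filter\<close>)
    qed
    from this[of k] this[of "Suc k"] show ?thesis
      using r_pos[of "Suc k"] k by auto
  qed
  \<comment> \<open>The core contains the centre, where u is continuously differentiable, so
    \<open>dir_deriv z u z\<close> tends to 0 there.\<close>
  have "A N = 0"
  proof (rule tendsto_unique)
    have C1: "C1_on (norm -` {..<r N}) u"
    proof -
      have sub: "norm -` {..<r N} \<subseteq> interior (layer N r N)"
        by (rule interior_maximal) (use N_pos in \<open>auto simp: layer_def intro!: open_vimage continuous_intros\<close>)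
      have "C2_on (interior (layer N r N)) u"
        using solution by (simp add: conductivity_solution_def)
      from C2_on_subset[OF this sub] show ?thesis
        by (simp add: C2_on_def)
    qed
    have "continuous_on (norm -` {..<r N}) ?f"
    proof (rule continuous_on_eq)
      show "Re z *\<^sub>R dir_deriv 1 u z + Im z *\<^sub>R dir_deriv \<i> u z = ?f z" if "z \<in> norm -` {..<r N}" for z
        using dir_deriv_eq[of u z z] C1 that by (simp add: C1_on_def)
      show "continuous_on (norm -` {..<r N}) (\<lambda>z. Re z *\<^sub>R dir_deriv 1 u z + Im z *\<^sub>R dir_deriv \<i> u z)"
        using C1 by (intro continuous_intros) (auto simp: C1_on_def)
    qed
    then have "continuous_on {0..<r N} (fourier ?f 0)"
      by (intro continuous_on_fourier) (auto elim: continuous_on_subset)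
    then have "(fourier ?f 0 \<longlongrightarrow> fourier ?f 0 0) (at 0 within {0..<r N})"
      using r_N_pos unfolding continuous_on_def by auto
    then have "(fourier ?f 0 \<longlongrightarrow> fourier ?f 0 0) (at 0 within {0<..<r N})"
      by (rule tendsto_within_subset) auto
    moreover have "fourier ?f 0 0 = 0"
    proof -
      have "dir_deriv 0 u 0 = 0"
        using dir_deriv_eq[of u 0 0] C1 r_N_pos by (simp add: C1_on_def)
      then show ?thesis by (simp add: fourier_def)
    qed
    moreover have "\<forall>\<^sub>F \<rho> in at 0 within {0<..<r N}. fourier ?f 0 \<rho> = A N"
      using A[of N] N_pos by (auto simp: eventually_at_filter radii_def)
    ultimately show "((\<lambda>_. A N) \<longlongrightarrow> 0) (at 0 within {0<..<r N})"
      using tendsto_cong by force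
    show "at 0 within {0<..<r N} \<noteq> bot"
      using r_N_pos by (simp add: trivial_limit_within islimpt_greaterThanLessThan1)
  qed auto
  have "A 0 = 0"
  proof (rule inc_induct[of 0 N "\<lambda>k. A k = 0"])
    show "A k = 0" if "k < N" "A (Suc k) = 0" for k
      using interface[OF that(1)] that \<sigma>_pos[of k] by auto
  qed (auto simp: \<open>A N = 0\<close>)
  have "C1_on (norm -` radii 0) u"
    using u_C2[of 0] by (simp add: C2_on_def)
  then have "(fourier u 0 has_vector_derivative 0) (at s within radii 0)" if "s \<in> radii 0" for s
    using fourier_zero_has_vector_derivative[OF open_radii convex_radii radii_pos \<open>C1_on (norm -` radii 0) u\<close> that]
      A[OF _ that] \<open>A 0 = 0\<close>
    by (auto intro: has_vector_derivative_at_within)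
  then obtain c where c: "\<And>s. s \<in> radii 0 \<Longrightarrow> fourier u 0 s = c"
    using has_vector_derivative_zero_constant[OF convex_radii] by metis
  have "\<forall>\<^sub>F s in at_top. fourier u 0 s - fourier H 0 s = c"
    using eventually_gt_at_top[of "r 1"]
    by eventually_elim (use c H r_pos[of 1] N_pos in \<open>auto simp: radii_0\<close>)
  then have "((\<lambda>s::real. c) \<longlongrightarrow> 0) at_top"
    using fourier_decay[of 0] tendsto_cong by force
  then have "c = 0"
    using tendsto_unique[OF trivial_limit_at_top_linorder tendsto_const] by force
  then show ?thesis
    using c assms(2) by (simp add: radii_0)
qed

end

section \<open>Completeness of the Fourier coefficients\<close>

lemma fourier_mult_z:
  "fourier (\<lambda>z. z * h z) m \<rho> = \<rho> * fourier h (m - 1) \<rho>"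
proof -
  have "rcis \<rho> t * h (rcis \<rho> t) * cis (- (of_int m * t)) =
      \<rho> * (h (rcis \<rho> t) * cis (- (of_int (m - 1) * t)))" for t
  proof -
    have "cis (- (of_int (m - 1) * t)) = cis t * cis (- (of_int m * t))"
      by (simp add: cis_mult algebra_simps)
    then show ?thesis by (simp add: rcis_def)
  qed
  then show ?thesis
    unfolding fourier_def by (simp only: integral_mult_right)
qed

lemma fourier_mult_cnj:
  "fourier (\<lambda>z. cnj z * h z) m \<rho> = \<rho> * fourier h (m + 1) \<rho>"
proof -
  have "cnj (rcis \<rho> t) * h (rcis \<rho> t) * cis (- (of_int m * t)) =
      \<rho> * (h (rcis \<rho> t) * cis (- (of_int (m + 1) * t)))" for t
  proof -
    have "cis (- (of_int (m + 1) * t)) = cis (- t) * cis (- (of_int m * t))"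
      by (simp add: cis_mult algebra_simps)
    then show ?thesis by (simp add: rcis_def cis_cnj)
  qed
  then show ?thesis
    unfolding fourier_def by (simp only: integral_mult_right)
qed

text \<open>Multiplication by z or \<open>cnj z\<close> only shifts frequencies, so it preserves the
  vanishing of all coefficients, and every real linear form is a combination of the two.
  \<open>h\<close> stays arbitrary because the product case absorbs one factor into it.\<close>

lemma fourier_mult_real_polynomial:
  assumes "real_polynomial_function p" "continuous_on (norm -` {\<bar>\<rho>\<bar>}) h" "\<And>m. fourier h m \<rho> = 0"
  shows "fourier (\<lambda>z. of_real (p z) * h z) m \<rho> = 0"
  using assms
proof (induction p arbitrary: h m rule: real_polynomial_function.induct)
  case (linear f)
  interpret bounded_linear f by fact
  \<comment> \<open>Chosen so that \<open>f z\<close> is twice the real part of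
    \<open>a * z\<close>.\<close>
  define a where "a = Complex (f 1 / 2) (- f \<i> / 2)"
  have "of_real (f z) = a * z + cnj a * cnj z" for z
  proof -
    have "f z = f (Re z *\<^sub>R 1 + Im z *\<^sub>R \<i>)"
      by (rule arg_cong[of _ _ f]) (simp add: complex_eq_iff)
    also have "\<dots> = Re z * f 1 + Im z * f \<i>"
      by (simp only: add scaleR) simp
    finally show ?thesis
      by (simp add: a_def complex_eq_iff)
  qed
  then have "fourier (\<lambda>z. of_real (f z) * h z) m \<rho> =
      fourier (\<lambda>z. a * (z * h z) + cnj a * (cnj z * h z)) m \<rho>"
    by (simp add: algebra_simps)
  also have "\<dots> = 0"
    using linear.prems
    by (subst fourier_add) (auto simp: fourier_mult_left fourier_mult_z fourier_mult_cnj intro!: continuous_intros)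
  finally show ?case .
next
  case (const c)
  then show ?case by (simp add: fourier_mult_left)
next
  case (add f g)
  have cont: "continuous_on (norm -` {\<bar>\<rho>\<bar>}) (\<lambda>z. of_real (p z) * h z)" if "real_polynomial_function p" for p
    using that add.prems(1)
    by (intro continuous_intros) (auto simp: real_polynomial_function_eq intro: continuous_on_polymonial_function)
  have "fourier (\<lambda>z. of_real (f z) * h z + of_real (g z) * h z) m \<rho> = 0"
    using add by (subst fourier_add) (auto intro!: cont)
  then show ?case
    by (simp add: distrib_right)
next
  case (mult f g)
  have "continuous_on (norm -` {\<bar>\<rho>\<bar>}) (\<lambda>z. of_real (g z) * h z)"
    using mult.hyps mult.prems(1)
    by (intro continuous_intros) (auto simp: real_polynomial_function_eq intro: continuous_on_polymonial_function)
  from mult.IH(1)[OF this] mult.IH(2)[OF mult.prems] show ?case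
    by (simp add: mult.assoc)
qed

text \<open>By \<open>fourier_mult_real_polynomial\<close> the integral of q^2 equals that of (q -
  p) q for every polynomial p, and Stone-Weierstrass makes the latter arbitrarily small.\<close>

lemma fourier_complete_real:
  fixes q :: "complex \<Rightarrow> real"
  assumes q: "continuous_on (norm -` {\<rho>}) q" and zero: "\<And>m. fourier (\<lambda>z. of_real (q z)) m \<rho> = 0"
    and "norm z = \<rho>"
  shows "q z = 0"
proof -
  let ?S = "norm -` {\<rho>} :: complex set"
  have \<rho>: "\<bar>\<rho>\<bar> = \<rho>"
    using assms(3) by auto
  have cq: "continuous_on ?S (\<lambda>z. complex_of_real (q z))"
    using q by (intro continuous_intros)
  have "compact ?S"
  proof -
    have "?S = sphere 0 \<rho>" by auto
    then show ?thesis by simp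
  qed
  then obtain B where B: "B > 0" "\<And>z. z \<in> ?S \<Longrightarrow> \<bar>q z\<bar> \<le> B"
    using compact_continuous_image[OF q] compact_imp_bounded bounded_pos by (metis image_eqI real_norm_def)
  let ?I = "fourier (\<lambda>z. of_real (q z) * of_real (q z)) 0 \<rho>"
  have "norm ?I \<le> e" if "e > 0" for e
  proof -
    \<comment> \<open>The resulting bound 2 pi \<epsilon> B is then exactly
      \<open>e\<close>.\<close>
    define \<epsilon> where "\<epsilon> = e / (2 * pi * B)"
    have "\<epsilon> > 0"
      using that B(1) by (simp add: \<epsilon>_def)
    then obtain p where p: "real_polynomial_function p" "\<And>x. x \<in> ?S \<Longrightarrow> \<bar>q x - p x\<bar> < \<epsilon>"
      using Stone_Weierstrass_real_polynomial_function[OF \<open>compact ?S\<close> q] by metis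
    have cp: "continuous_on ?S (\<lambda>z. complex_of_real (p z))"
      using p(1) by (intro continuous_intros) (auto simp: real_polynomial_function_eq intro: continuous_on_polymonial_function)
    have "?I = ?I - fourier (\<lambda>z. of_real (p z) * of_real (q z)) 0 \<rho>"
      using fourier_mult_real_polynomial[OF p(1), of \<rho> "\<lambda>z. of_real (q z)" 0] cq zero by (simp add: \<rho>)
    also have "\<dots> = fourier (\<lambda>z. of_real (q z) * of_real (q z) - of_real (p z) * of_real (q z)) 0 \<rho>"
      using cp cq by (intro fourier_diff[symmetric] continuous_intros) (simp_all add: \<rho>)
    also have "norm \<dots> \<le> 2 * pi * (\<epsilon> * B)"
    proof (rule norm_fourier_le)
      show "continuous_on (norm -` {\<bar>\<rho>\<bar>}) (\<lambda>z. complex_of_real (q z) * of_real (q z) - of_real (p z) * of_real (q z))"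
        using cp cq by (intro continuous_intros) (simp_all add: \<rho>)
      fix x :: complex
      assume "norm x = \<bar>\<rho>\<bar>"
      then have "\<bar>q x - p x\<bar> * \<bar>q x\<bar> \<le> \<epsilon> * B"
        using p(2)[of x] B(2)[of x] \<rho> \<open>\<epsilon> > 0\<close> by (intro mult_mono) auto
      moreover have "complex_of_real (q x) * of_real (q x) - of_real (p x) * of_real (q x) = of_real ((q x - p x) * q x)"
        by (simp add: algebra_simps)
      ultimately show "norm (complex_of_real (q x) * of_real (q x) - of_real (p x) * of_real (q x)) \<le> \<epsilon> * B"
        by (simp only: norm_of_real abs_mult)
    qed
    also have "2 * pi * (\<epsilon> * B) = e"
      using B(1) by (simp add: \<epsilon>_def)
    finally show ?thesis .
  qed
  then have "?I = 0"
    using field_le_epsilon[of "norm ?I" 0] by simp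
  have cr: "continuous_on {0..2*pi} (\<lambda>t. q (rcis \<rho> t) * q (rcis \<rho> t))"
    by (intro continuous_intros continuous_on_compose2[OF q]) (auto simp: \<rho>)
  have "((\<lambda>t. complex_of_real (q (rcis \<rho> t) * q (rcis \<rho> t))) has_integral
      of_real (integral {0..2*pi} (\<lambda>t. q (rcis \<rho> t) * q (rcis \<rho> t)))) {0..2*pi}"
    by (intro has_integral_of_real integrable_integral integrable_continuous_real cr)
  then have "complex_of_real (integral {0..2*pi} (\<lambda>t. q (rcis \<rho> t) * q (rcis \<rho> t))) = 0"
    using \<open>?I = 0\<close> by (simp add: fourier_def integral_unique)
  then have "integral (cbox 0 (2*pi)) (\<lambda>t. q (rcis \<rho> t) * q (rcis \<rho> t)) = 0"
    by simp
  then have q0: "q (rcis \<rho> t) = 0" if "t \<in> {0..2*pi}" for t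
    using integral_cbox_eq_0_iff[of 0 "2*pi" "\<lambda>t. q (rcis \<rho> t) * q (rcis \<rho> t)"] cr that
    by (auto simp: not_le)
  \<comment> \<open>\<open>Arg\<close> takes values in (-pi, pi] while the integral runs over
    [0, 2 pi]; negative arguments are shifted by a full turn.\<close>
  obtain t where "t \<in> {0..2*pi}" "z = rcis \<rho> t"
  proof (cases "Arg z \<ge> 0")
    case True
    then show ?thesis
      using that[of "Arg z"] Arg_le_pi[of z] rcis_cmod_Arg[of z] assms(3) pi_gt_zero by auto
  next
    case False
    have "rcis \<rho> (Arg z + 2 * pi) = rcis \<rho> (Arg z)"
      by (simp add: rcis_def complex_eq_iff)
    then show ?thesis
      using that[of "Arg z + 2 * pi"] False mpi_less_Arg[of z] rcis_cmod_Arg[of z] assms(3) pi_gt_zero by auto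
  qed
  with q0 show ?thesis by blast
qed

text \<open>The coefficients of the real part of \<open>c * g\<close> come from those of
  \<open>g\<close> and of its conjugate, which reduces to the real case; c = 1 and c = -i yield the
  real and the imaginary part of \<open>g\<close>.\<close>

lemma fourier_complete:
  assumes g: "continuous_on (norm -` {\<rho>}) g" and zero: "\<And>m. fourier g m \<rho> = 0" and "norm z = \<rho>"
  shows "g z = 0"
proof -
  have \<rho>: "\<bar>\<rho>\<bar> = \<rho>"
    using assms(3) by auto
  have Re: "Re (c * g z) = 0" for c
  proof (rule fourier_complete_real[OF _ _ \<open>norm z = \<rho>\<close>])
    show "continuous_on (norm -` {\<rho>}) (\<lambda>z. Re (c * g z))"
      using g by (intro continuous_intros)
    have "(\<lambda>z. complex_of_real (Re (c * g z))) = (\<lambda>z. c / 2 * g z + cnj c / 2 * cnj (g z))"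
      by (auto simp: fun_eq_iff complex_eq_iff field_simps)
    moreover have "fourier (\<lambda>z. b * g z + d * cnj (g z)) m \<rho> = 0" for b d m
      using g by (subst fourier_add) (auto simp: \<rho> zero fourier_mult_left fourier_cnj intro!: continuous_intros)
    ultimately show "fourier (\<lambda>z. complex_of_real (Re (c * g z))) m \<rho> = 0" for m
      by (simp only:)
  qed
  show ?thesis
    using Re[of 1] Re[of "- \<i>"] by (simp add: complex_eq_iff)
qed

section \<open>Adjugates and the matrices of the statement\<close>

text \<open>Cramer's rule without division: the adjugate is applied to both sides of A x =
  e.\<close>

lemma adj_mat_solution:
  fixes A :: "real mat"
  assumes A: "A \<in> carrier_mat N N" and x: "\<And>p. p < N \<Longrightarrow> (\<Sum>q<N. A $$ (p, q) * x q) = 1" and "q < N"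
  shows "(\<Sum>p<N. adj_mat A $$ (q, p)) = Determinant.det A * x q"
proof -
  have adj: "adj_mat A \<in> carrier_mat N N"
    using adj_mat(1)[OF A] .
  have "(\<Sum>p<N. adj_mat A $$ (q, p) * A $$ (p, l)) = (if q = l then Determinant.det A else 0)" if "l < N" for l
  proof -
    have "(adj_mat A * A) $$ (q, l) = (Determinant.det A \<cdot>\<^sub>m 1\<^sub>m N) $$ (q, l)"
      using adj_mat(3)[OF A] by simp
    then show ?thesis
      using A adj \<open>q < N\<close> that by (simp add: scalar_prod_def atLeast0LessThan)
  qed
  note adjA = this
  have "(\<Sum>p<N. adj_mat A $$ (q, p)) = (\<Sum>p<N. adj_mat A $$ (q, p) * (\<Sum>l<N. A $$ (p, l) * x l))"
    by (simp add: x)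
  also have "\<dots> = (\<Sum>l<N. (\<Sum>p<N. adj_mat A $$ (q, p) * A $$ (p, l)) * x l)"
    unfolding sum_distrib_left sum_distrib_right by (subst sum.swap) (simp add: mult.assoc)
  also have "\<dots> = (\<Sum>l<N. (if q = l then Determinant.det A else 0) * x l)"
    by (simp add: adjA)
  also have "\<dots> = Determinant.det A * x q"
    using \<open>q < N\<close> by (simp add: if_distrib[of "\<lambda>t. t * _"] cong: if_cong)
  finally show ?thesis .
qed

text \<open>The identity adj A (A - B) adj B = det A adj B - det B adj A holds even for singular matrices, so the
  polarization matrices need not be shown to be invertible.\<close>

lemma adj_mat_resolvent:
  fixes A B :: "real mat"
  assumes A: "A \<in> carrier_mat N N" and B: "B \<in> carrier_mat N N"
    and x: "\<And>p. p < N \<Longrightarrow> (\<Sum>q<N. A $$ (p, q) * x q) = 1"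
    and y: "\<And>p. p < N \<Longrightarrow> (\<Sum>q<N. B $$ (p, q) * y q) = 1"
    and eq: "(\<Sum>p<N. w p * x p) = (\<Sum>p<N. w p * y p)"
    and diag: "\<And>p q. p < N \<Longrightarrow> q < N \<Longrightarrow> A $$ (p, q) - B $$ (p, q) = (if p = q then c p else 0)"
  shows "(\<Sum>l<N. (\<Sum>p<N. w p * adj_mat A $$ (p, l)) * (\<Sum>j<N. adj_mat B $$ (l, j)) * c l) = 0"
proof -
  define L where "L l = (\<Sum>p<N. w p * adj_mat A $$ (p, l))" for l
  define R where "R l = (\<Sum>j<N. adj_mat B $$ (l, j))" for l
  have R: "R l = Determinant.det B * y l" if "l < N" for l
    unfolding R_def using adj_mat_solution[OF B y that] .
  have L: "(\<Sum>l<N. L l) = Determinant.det A * (\<Sum>p<N. w p * x p)"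
  proof -
    have "(\<Sum>l<N. L l) = (\<Sum>p<N. w p * (\<Sum>l<N. adj_mat A $$ (p, l)))"
      unfolding L_def sum_distrib_left by (rule sum.swap)
    also have "\<dots> = (\<Sum>p<N. w p * (Determinant.det A * x p))"
      using adj_mat_solution[OF A x] by simp
    finally show ?thesis
      by (simp add: sum_distrib_left mult_ac)
  qed
  have LA: "(\<Sum>l<N. L l * A $$ (l, m)) = Determinant.det A * w m" if "m < N" for m
  proof -
    have "(\<Sum>l<N. adj_mat A $$ (p, l) * A $$ (l, m)) = (if p = m then Determinant.det A else 0)" if "p < N" for p
    proof -
      have "(adj_mat A * A) $$ (p, m) = (Determinant.det A \<cdot>\<^sub>m 1\<^sub>m N) $$ (p, m)"
        using adj_mat(3)[OF A] by simp
      then show ?thesis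
        using A adj_mat(1)[OF A] \<open>m < N\<close> that by (simp add: scalar_prod_def atLeast0LessThan)
    qed
    note adjA = this
    have "(\<Sum>l<N. L l * A $$ (l, m)) = (\<Sum>p<N. w p * (\<Sum>l<N. adj_mat A $$ (p, l) * A $$ (l, m)))"
      unfolding L_def sum_distrib_left sum_distrib_right by (subst sum.swap) (simp add: mult.assoc)
    also have "\<dots> = (\<Sum>p<N. w p * (if p = m then Determinant.det A else 0))"
      by (simp add: adjA)
    also have "\<dots> = Determinant.det A * w m"
      using that by (simp add: if_distrib[of "\<lambda>t. _ * t"] cong: if_cong)
    finally show ?thesis .
  qed
  \<comment> \<open>In matrix form, with e the vector of ones, w^T adj A (A - B) adj B e = det A det
    B (w . y - w . x), and \<open>eq\<close> makes this zero.\<close>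
  have "(\<Sum>l<N. L l * R l * c l) = (\<Sum>l<N. \<Sum>m<N. L l * (A $$ (l, m) - B $$ (l, m)) * R m)"
  proof (rule sum.cong[OF refl])
    fix l assume l: "l \<in> {..<N}"
    have "(\<Sum>m<N. L l * (A $$ (l, m) - B $$ (l, m)) * R m) = (\<Sum>m<N. if l = m then L l * R l * c l else 0)"
      using l by (intro sum.cong) (auto simp: diag)
    then show "L l * R l * c l = (\<Sum>m<N. L l * (A $$ (l, m) - B $$ (l, m)) * R m)"
      using l by simp
  qed
  also have "\<dots> = (\<Sum>l<N. \<Sum>m<N. L l * A $$ (l, m) * R m) - (\<Sum>l<N. \<Sum>m<N. L l * B $$ (l, m) * R m)"
    by (simp add: sum_subtractf[symmetric] algebra_simps)
  also have "(\<Sum>l<N. \<Sum>m<N. L l * A $$ (l, m) * R m) = (\<Sum>m<N. (\<Sum>l<N. L l * A $$ (l, m)) * R m)"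
    unfolding sum_distrib_right by (rule sum.swap)
  also have "\<dots> = (\<Sum>m<N. Determinant.det A * w m * (Determinant.det B * y m))"
    by (simp add: LA R)
  also have "\<dots> = Determinant.det A * Determinant.det B * (\<Sum>m<N. w m * y m)"
    by (simp add: sum_distrib_left mult_ac)
  also have "(\<Sum>l<N. \<Sum>m<N. L l * B $$ (l, m) * R m) = (\<Sum>l<N. L l * (\<Sum>m<N. B $$ (l, m) * (Determinant.det B * y m)))"
    by (simp add: sum_distrib_left mult.assoc R)
  also have "\<dots> = (\<Sum>l<N. L l * (Determinant.det B * (\<Sum>m<N. B $$ (l, m) * y m)))"
    by (simp add: sum_distrib_left mult_ac)
  also have "\<dots> = Determinant.det B * (\<Sum>l<N. L l)"
    using y by (simp add: sum_distrib_left mult_ac)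
  finally show ?thesis
    unfolding L_def[symmetric] R_def[symmetric] L eq by simp
qed

lemma invertible_mat_kernel:
  fixes T :: "real mat"
  assumes T: "T \<in> carrier_mat N N" and "invertible_mat T"
    and zero: "\<And>k. k < N \<Longrightarrow> (\<Sum>l<N. T $$ (k, l) * c l) = 0" and "l < N"
  shows "c l = 0"
proof -
  obtain B where "inverts_mat T B" and BT: "inverts_mat B T"
    using \<open>invertible_mat T\<close> by (auto simp: invertible_mat_def)
  have B: "B \<in> carrier_mat N N"
  proof -
    have "dim_col B = N"
      using \<open>inverts_mat T B\<close> T unfolding inverts_mat_def by (metis carrier_matD index_mult_mat(3) index_one_mat(3))
    moreover have "dim_row B = N"
      using BT T unfolding inverts_mat_def by (metis carrier_matD index_mult_mat(3) index_one_mat(3))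
    ultimately show ?thesis by auto
  qed
  have "c l = (\<Sum>m<N. (1\<^sub>m N :: real mat) $$ (l, m) * c m)"
    using \<open>l < N\<close> by (simp add: if_distrib[of "\<lambda>t. t * _"] cong: if_cong)
  also have "\<dots> = (\<Sum>m<N. (\<Sum>k<N. B $$ (l, k) * T $$ (k, m)) * c m)"
  proof (rule sum.cong[OF refl])
    fix m assume "m \<in> {..<N}"
    then have "(B * T) $$ (l, m) = (\<Sum>k<N. B $$ (l, k) * T $$ (k, m))"
      using B T \<open>l < N\<close> by (simp add: scalar_prod_def atLeast0LessThan)
    moreover have "B * T = 1\<^sub>m N"
      using BT B by (simp add: inverts_mat_def)
    ultimately show "(1\<^sub>m N :: real mat) $$ (l, m) * c m = (\<Sum>k<N. B $$ (l, k) * T $$ (k, m)) * c m"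
      by simp
  qed
  also have "\<dots> = (\<Sum>k<N. B $$ (l, k) * (\<Sum>m<N. T $$ (k, m) * c m))"
    unfolding sum_distrib_left sum_distrib_right by (subst sum.swap) (simp add: mult.assoc)
  also have "\<dots> = 0"
    by (simp add: zero)
  finally show ?thesis .
qed

text \<open>The list in \<open>L_mat\<close> starts at 1, so row k of the library matrix belongs to
  the order \<open>i (Suc k)\<close>; the columns of \<open>R_mat\<close> are shifted
  likewise.\<close>

lemma L_mat_entry:
  assumes "k < N" "l < N"
  shows "L_mat N r \<sigma> i $$ (k, l) =
    (\<Sum>p<N. r (Suc p) ^ (2 * i (Suc k)) * adj_mat (gpm N r \<sigma> (i (Suc k))) $$ (p, l))"
proof -
  let ?n = "i (Suc k)"
  have G: "adj_mat (gpm N r \<sigma> ?n) \<in> carrier_mat N N"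
    by (rule adj_mat(1)) (simp add: gpm_def)
  have E: "transpose_mat (ones N) \<in> carrier_mat 1 N"
    by (simp add: ones_def)
  have Y: "Upsilon N r ?n \<in> carrier_mat N N"
    by (simp add: Upsilon_def)
  have EY: "(transpose_mat (ones N) * Upsilon N r ?n) $$ (0, p) = r (Suc p) ^ (2 * ?n)" if "p < N" for p
  proof -
    have "(transpose_mat (ones N) * Upsilon N r ?n) $$ (0, p) = (\<Sum>q<N. if q = p then r (Suc p) ^ (2 * ?n) else 0)"
      using that by (auto simp: ones_def Upsilon_def mat_diag_def scalar_prod_def atLeast0LessThan intro!: sum.cong)
    then show ?thesis
      using that by simp
  qed
  have "L_mat N r \<sigma> i $$ (k, l) =
      Matrix.row (transpose_mat (ones N) * Upsilon N r ?n * adj_mat (gpm N r \<sigma> ?n)) 0 $ l"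
    using assms by (simp add: L_mat_def mat_of_rows_index del: upt_Suc)
  also have "\<dots> = (transpose_mat (ones N) * Upsilon N r ?n * adj_mat (gpm N r \<sigma> ?n)) $$ (0, l)"
    by (rule index_row) (use assms G in \<open>simp_all add: ones_def\<close>)
  also have "\<dots> = (\<Sum>p<N. (transpose_mat (ones N) * Upsilon N r ?n) $$ (0, p) * adj_mat (gpm N r \<sigma> ?n) $$ (p, l))"
  proof -
    have "(W * X) $$ (0, l) = (\<Sum>p<N. W $$ (0, p) * X $$ (p, l))"
      if "W \<in> carrier_mat 1 N" "X \<in> carrier_mat N N" for W X :: "real mat"
      using that assms by (simp add: scalar_prod_def atLeast0LessThan)
    then show ?thesis
      using mult_carrier_mat[OF E Y] G by blast
  qed
  finally show ?thesis
    by (simp add: EY)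
qed

lemma R_mat_entry:
  assumes "k < N" "l < N"
  shows "R_mat N r \<sigma> i $$ (l, k) = (\<Sum>j<N. adj_mat (gpm N r \<sigma> (i (Suc k))) $$ (l, j))"
proof -
  have G: "adj_mat (gpm N r \<sigma> (i (Suc k))) \<in> carrier_mat N N"
    by (rule adj_mat(1)) (simp add: gpm_def)
  have "R_mat N r \<sigma> i $$ (l, k) = Matrix.col (adj_mat (gpm N r \<sigma> (i (Suc k))) * ones N) 0 $ l"
    using assms by (simp add: R_mat_def mat_of_cols_index del: upt_Suc)
  also have "\<dots> = (adj_mat (gpm N r \<sigma> (i (Suc k))) * ones N) $$ (l, 0)"
    by (rule index_col) (use assms G in \<open>simp_all add: ones_def\<close>)
  also have "\<dots> = (\<Sum>j<N. adj_mat (gpm N r \<sigma> (i (Suc k))) $$ (l, j))"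
    using assms G by (simp add: ones_def scalar_prod_def atLeast0LessThan)
  finally show ?thesis .
qed

text \<open>For a fixed nonzero \<open>\<sigma> (k - 1)\<close> the contrast is a Moebius function
  of \<open>\<sigma> k\<close> with nonzero determinant, hence injective.\<close>

lemma contrast_inject:
  assumes "\<sigma> k \<noteq> \<sigma> (k - 1)" "\<tau> k \<noteq> \<tau> (k - 1)" "\<sigma> (k - 1) = \<tau> (k - 1)" "\<sigma> (k - 1) \<noteq> 0"
    and "contrast \<sigma> k = contrast \<tau> k"
  shows "\<sigma> k = \<tau> k"
proof -
  define s x y where "s = \<sigma> (k - 1)" and "x = \<sigma> k" and "y = \<tau> k"
  have "(x + s) / (2 * (x - s)) = (y + s) / (2 * (y - s))" "x - s \<noteq> 0" "y - s \<noteq> 0"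
    using assms by (auto simp: contrast_def s_def x_def y_def)
  then have "(x + s) * (2 * (y - s)) = (y + s) * (2 * (x - s))"
    by (simp add: frac_eq_eq)
  then have "s * (y - x) = 0"
    by (simp add: algebra_simps)
  then show ?thesis
    using assms(4) by (simp add: s_def x_def y_def)
qed

section \<open>The uniqueness theorem\<close>

lemma background_eq: "background N i a = (\<lambda>x. \<Sum>k=1..N. a (i k) * x ^ i k)"
proof
  fix x
  have "x ^ n = of_real (norm x ^ n) * exp (\<i> * of_real (real n * Arg x))" for n
  proof -
    have "x ^ n = rcis (norm x) (Arg x) ^ n"
      by (simp only: rcis_cmod_Arg)
    also have "\<dots> = of_real (norm x ^ n) * exp (\<i> * of_real (real n * Arg x))"
      unfolding DeMoivre2 by (simp only: rcis_def cis_conv_exp)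
    finally show ?thesis .
  qed
  then show "background N i a x = (\<Sum>k=1..N. a (i k) * x ^ i k)"
    by (simp add: background_def mult.assoc)
qed

lemma fourier_power:
  assumes "\<rho> > 0"
  shows "fourier (\<lambda>z. z ^ n) m \<rho> = (if int n = m then 2 * pi * \<rho> ^ n else 0)"
  using fourier_powi[of \<rho> "int n" m] assms by (cases "int n = m") auto

text \<open>1 / cnj z^n is the decaying harmonic function with the same positive frequency as z^n:
  its modulus is \<rho>^(-n) and its angular part e^(i n t).\<close>

lemma fourier_inverse_cnj_power:
  assumes "\<rho> > 0"
  shows "fourier (\<lambda>z. 1 / cnj z ^ n) m \<rho> = (if int n = m then 2 * pi / \<rho> ^ n else 0)"
proof -
  have "fourier (\<lambda>z. 1 / cnj z ^ n) m \<rho> = fourier (\<lambda>z. cnj (z powi (- int n))) m \<rho>"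
    by (intro fourier_cong) (simp add: power_int_minus divide_inverse)
  also have "\<dots> = (if int n = m then 2 * pi / \<rho> ^ n else 0)"
    unfolding fourier_cnj using assms by (subst fourier_powi) (auto simp: power_int_minus divide_inverse)
  finally show ?thesis .
qed

lemma sum_powers_zero_on_infinite:
  fixes c :: "nat \<Rightarrow> complex"
  assumes "finite K" "inj_on i K" "infinite S" "\<And>z. z \<in> S \<Longrightarrow> (\<Sum>k\<in>K. c k * z ^ i k) = 0" "k \<in> K"
  shows "c k = 0"
proof -
  define p where "p = (\<Sum>k\<in>K. Polynomial.monom (c k) (i k))"
  have "S \<subseteq> {z. poly p z = 0}"
    using assms(4) by (auto simp: p_def poly_sum poly_monom)
  then have "p = 0"
    using poly_roots_finite[of p] finite_subset assms(3) by blast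
  then have "0 = poly.coeff p (i k)"
    by simp
  also have "\<dots> = (\<Sum>j\<in>K. if j = k then c k else 0)"
    using assms(2,5) by (auto simp: p_def coeff_sum inj_on_def intro!: sum.cong)
  also have "\<dots> = c k"
    using assms(1,5) by simp
  finally show ?thesis by simp
qed

lemma (in concentric_layers) disk_subset_layers:
  assumes "norm x \<le> r 1"
  shows "x \<in> (\<Union>k\<in>{1..N}. layer N r k)"
proof -
  \<comment> \<open>The innermost interface circle that still encloses x.\<close>
  define k where "k = Max {k \<in> {1..N}. norm x \<le> r k}"
  have fin: "finite {k \<in> {1..N}. norm x \<le> r k}"
    by simp
  have "k \<in> {k \<in> {1..N}. norm x \<le> r k}"
    unfolding k_def using assms N_pos by (intro Max_in fin) auto
  then have k: "k \<in> {1..N}" "norm x \<le> r k"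
    by auto
  moreover have "r (k + 1) < norm x" if "k < N"
  proof (rule ccontr)
    assume "\<not> r (k + 1) < norm x"
    then have "k + 1 \<le> k"
      using that unfolding k_def by (intro Max_ge fin) auto
    then show False by simp
  qed
  ultimately have "x \<in> layer N r k"
    by (auto simp: layer_def)
  with k show ?thesis by blast
qed

context transmission_solution
begin

text \<open>Assembles all frequencies. An order of the background goes through
  \<open>exterior_fourier\<close> with amplitude 2 pi a k, the factor being that of the unnormalised
  \<open>fourier\<close>; any other frequency, 0 and the negative ones included, has no source and
  leaves no field outside.\<close>

lemma exterior_coefficients:
  fixes a :: "nat \<Rightarrow> complex" and i :: "nat \<Rightarrow> nat"
  assumes \<sigma>: "\<And>k. k < N \<Longrightarrow> \<sigma> (Suc k) \<noteq> \<sigma> k"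
    and H: "H = (\<lambda>x. \<Sum>k=1..N. a k * x ^ i k)"
    and i: "inj_on i {1..N}" "\<And>k. k \<in> {1..N} \<Longrightarrow> 1 \<le> i k"
  shows "\<exists>\<gamma> d :: nat \<Rightarrow> nat \<Rightarrow> complex.
    (\<forall>m. \<forall>\<rho>>r 1. fourier u m \<rho> = fourier H m \<rho> + (\<Sum>k=1..N. if int (i k) = m then \<gamma> k / of_real (\<rho> ^ i k) else 0)) \<and>
    (\<forall>k\<in>{1..N}. \<forall>p<N. (\<Sum>q<N. of_real (gpm N r \<sigma> (i k) $$ (p, q)) * d k q) = 2 * pi * a k) \<and>
    (\<forall>k\<in>{1..N}. (\<Sum>q<N. of_real (r (Suc q) ^ (2 * i k)) * d k q) = \<gamma> k)"
proof -
  define h where "h m = (\<Sum>k=1..N. if int (i k) = m then 2 * pi * a k else 0)" for m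
  have FH: "fourier H m \<rho> = h m * \<rho> ^ nat \<bar>m\<bar>" if "\<rho> > 0" for m \<rho>
  proof -
    have "fourier H m \<rho> = (\<Sum>k=1..N. fourier (\<lambda>z. a k * z ^ i k) m \<rho>)"
      unfolding H by (intro fourier_sum continuous_intros) auto
    also have "\<dots> = (\<Sum>k=1..N. (if int (i k) = m then 2 * pi * a k else 0) * \<rho> ^ nat \<bar>m\<bar>)"
      using that by (intro sum.cong) (auto simp: fourier_mult_left fourier_power)
    finally show ?thesis
      by (simp add: h_def sum_distrib_right)
  qed
  have single: "(\<Sum>j=1..N. if int (i j) = int (i k) then f j else 0) = f k" if "k \<in> {1..N}" for k and f :: "nat \<Rightarrow> complex"
  proof -
    have "(\<Sum>j=1..N. if int (i j) = int (i k) then f j else 0) = (\<Sum>j=1..N. if j = k then f k else 0)"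
      using that by (intro sum.cong refl) (auto simp: inj_on_eq_iff[OF i(1)])
    then show ?thesis
      using that by simp
  qed
  have none: "(\<Sum>j=1..N. if int (i j) = m then f j else 0) = 0" if "m \<notin> (\<lambda>k. int (i k)) ` {1..N}" for m and f :: "nat \<Rightarrow> complex"
    using that by (intro sum.neutral) auto
  define Q where "Q k \<gamma> d \<longleftrightarrow>
      (\<forall>\<rho>. \<rho> > r 1 \<longrightarrow> fourier u (int (i k)) \<rho> = 2 * pi * a k * of_real (\<rho> ^ i k) + \<gamma> / of_real (\<rho> ^ i k)) \<and>
      (\<forall>p. p < N \<longrightarrow> (\<Sum>q<N. of_real (gpm N r \<sigma> (i k) $$ (p, q)) * d q) = 2 * pi * a k) \<and>
      (\<Sum>q<N. of_real (r (Suc q) ^ (2 * i k)) * d q) = \<gamma>" for k \<gamma> and d :: "nat \<Rightarrow> complex"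
  have "\<exists>p. Q k (fst p) (snd p)" if k: "k \<in> {1..N}" for k
  proof -
    have FHk: "fourier H (int (i k)) \<rho> = 2 * pi * a k * of_real (\<rho> ^ i k)" if "\<rho> > 0" for \<rho>
      using FH[OF that, of "int (i k)"] single[OF k] by (simp add: h_def)
    have nz: "int (i k) \<noteq> 0" "i k = nat \<bar>int (i k)\<bar>"
      using i(2)[OF k] by auto
    show ?thesis
    proof (rule exterior_fourier[OF \<sigma> nz FHk])
      fix \<gamma> d
      assume "\<And>\<rho>. \<rho> > r 1 \<Longrightarrow> fourier u (int (i k)) \<rho> = 2 * pi * a k * of_real (\<rho> ^ i k) + \<gamma> / of_real (\<rho> ^ i k)"
        "\<And>p. p < N \<Longrightarrow> (\<Sum>q<N. of_real (gpm N r \<sigma> (i k) $$ (p, q)) * d q) = 2 * pi * a k"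
        "(\<Sum>q<N. of_real (r (Suc q) ^ (2 * i k)) * d q) = \<gamma>"
      then have "Q k \<gamma> d"
        unfolding Q_def by blast
      then show ?thesis
        by (intro exI[of _ "(\<gamma>, d)"]) simp
    qed
  qed
  then obtain p where p: "\<And>k. k \<in> {1..N} \<Longrightarrow> Q k (fst (p k)) (snd (p k))"
    by metis
  have expansion: "fourier u m \<rho> = fourier H m \<rho> + (\<Sum>k=1..N. if int (i k) = m then fst (p k) / of_real (\<rho> ^ i k) else 0)"
    if \<rho>: "\<rho> > r 1" for m \<rho>
  proof (cases "m \<in> (\<lambda>k. int (i k)) ` {1..N}")
    case True
    then obtain k where k: "k \<in> {1..N}" "m = int (i k)"
      by auto
    have "\<rho> > 0"
      using \<rho> r_pos[of 1] N_pos by simp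
    have "fourier u m \<rho> = 2 * pi * a k * of_real (\<rho> ^ i k) + fst (p k) / of_real (\<rho> ^ i k)"
      using p[OF k(1)] \<rho> unfolding Q_def k(2) by blast
    moreover have "fourier H m \<rho> = 2 * pi * a k * of_real (\<rho> ^ i k)"
      using FH[OF \<open>\<rho> > 0\<close>, of "int (i k)"] single[OF k(1)] by (simp add: h_def k(2))
    ultimately show ?thesis
      using single[OF k(1), of "\<lambda>k. fst (p k) / of_real (\<rho> ^ i k)"] k(2) by simp
  next
    case False
    then have "h m = 0"
      unfolding h_def by (rule none)
    then have FH0: "fourier H m \<rho> = 0" if "\<rho> > 0" for \<rho>
      using FH[OF that, of m] by simp
    have "fourier u m \<rho> = 0"
    proof (cases "m = 0")
      case True
      then show ?thesis
        using exterior_fourier_zero[OF _ \<rho>] FH0 by simp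
    next
      case m: False
      have FHm: "fourier H m \<rho> = (0::complex) * of_real (\<rho> ^ nat \<bar>m\<bar>)" if "\<rho> > 0" for \<rho>
        using FH0[OF that] by simp
      show ?thesis
        by (rule exterior_fourier[OF \<sigma> m refl FHm]) (use \<rho> in auto)
    qed
    moreover have "\<rho> > 0"
      using \<rho> r_pos[of 1] N_pos by simp
    ultimately show ?thesis
      using FH0 none[OF False, of "\<lambda>k. fst (p k) / of_real (\<rho> ^ i k)"] by simp
  qed
  show ?thesis
    by (rule exI[of _ "\<lambda>k. fst (p k)"], rule exI[of _ "\<lambda>k. snd (p k)"])
      (use expansion p in \<open>simp add: Q_def\<close>)
qed

end

text \<open>A nonempty relatively open part of the frontier of a domain can be a single isolated
  point, as for a punctured disk; \<open>infinite P\<close> asks for a genuine piece of the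
  boundary. Nonzero coefficients make each of the N orders contribute an equation.\<close>

theorem theorem5p5:
  fixes N M :: nat
    and r \<sigma>1 \<sigma>2 :: "nat \<Rightarrow> real"
    and i :: "nat \<Rightarrow> nat"
    and a :: "nat \<Rightarrow> complex"
    and u1 u2 :: "complex \<Rightarrow> complex"
    and \<Omega> P :: "complex set"
  assumes "N \<ge> 1"
    and "strict_antimono_on {1..N} r" and "r N > 0"
    and "\<sigma>1 0 = 1" and "\<And>k. k \<in> {1..N} \<Longrightarrow> \<sigma>1 k > 0 \<and> \<sigma>1 k \<noteq> \<sigma>1 (k - 1)"
    and "\<sigma>2 0 = 1" and "\<And>k. k \<in> {1..N} \<Longrightarrow> \<sigma>2 k > 0 \<and> \<sigma>2 k \<noteq> \<sigma>2 (k - 1)"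
    and "M > N"
    and "strict_mono_on {1..N} i" and "\<And>k. k \<in> {1..N} \<Longrightarrow> 1 \<le> i k \<and> i k \<le> M"
    and "\<And>k. k \<in> {1..N} \<Longrightarrow> a (i k) \<noteq> 0"
    and "conductivity_solution N r \<sigma>1 (background N i a) u1"
    and "conductivity_solution N r \<sigma>2 (background N i a) u2"
    and "invertible_mat (T_mat N r \<sigma>1 \<sigma>2 i)"
    and "open \<Omega>" and "connected \<Omega>" and "bounded \<Omega>"
    and "(\<Union>k\<in>{1..N}. layer N r k) \<subseteq> \<Omega>"
    and "openin (top_of_set (frontier \<Omega>)) P" and "infinite P"
    and "\<And>x. x \<in> P \<Longrightarrow> u1 x = u2 x"
  shows "\<forall>k\<in>{1..N}. \<sigma>1 k = \<sigma>2 k"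
proof -
  let ?H = "background N i a"
  have H: "?H = (\<lambda>x. \<Sum>k=1..N. a (i k) * x ^ i k)"
    by (rule background_eq)
  have "continuous_on UNIV ?H"
    unfolding H by (intro continuous_intros)
  interpret S1: transmission_solution N r \<sigma>1 ?H u1
  proof
    show "\<sigma>1 k > 0" if "k \<le> N" for k
      using assms(4,5) that by (cases "k = 0") auto
  qed (use assms \<open>continuous_on UNIV ?H\<close> in auto)
  interpret S2: transmission_solution N r \<sigma>2 ?H u2
  proof
    show "\<sigma>2 k > 0" if "k \<le> N" for k
      using assms(6,7) that by (cases "k = 0") auto
  qed (use assms \<open>continuous_on UNIV ?H\<close> in auto)
  have \<sigma>1: "\<sigma>1 (Suc k) \<noteq> \<sigma>1 k" and \<sigma>2: "\<sigma>2 (Suc k) \<noteq> \<sigma>2 k" if "k < N" for k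
    using assms(5)[of "Suc k"] assms(7)[of "Suc k"] that by auto
  have inj: "inj_on i {1..N}"
    using assms(9) by (rule strict_mono_on_imp_inj_on)
  have i1: "1 \<le> i k" if "k \<in> {1..N}" for k
    using assms(10)[OF that] by simp
  obtain \<gamma>1 d1 where
    u1: "\<forall>m. \<forall>\<rho>>r 1. fourier u1 m \<rho> = fourier ?H m \<rho> + (\<Sum>k=1..N. if int (i k) = m then \<gamma>1 k / of_real (\<rho> ^ i k) else 0)"
    and d1: "\<forall>k\<in>{1..N}. \<forall>p<N. (\<Sum>q<N. of_real (gpm N r \<sigma>1 (i k) $$ (p, q)) * d1 k q) = 2 * pi * a (i k)"
    and \<gamma>1: "\<forall>k\<in>{1..N}. (\<Sum>q<N. of_real (r (Suc q) ^ (2 * i k)) * d1 k q) = \<gamma>1 k"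
    using S1.exterior_coefficients[OF \<sigma>1 H inj i1] by blast
  obtain \<gamma>2 d2 where
    u2: "\<forall>m. \<forall>\<rho>>r 1. fourier u2 m \<rho> = fourier ?H m \<rho> + (\<Sum>k=1..N. if int (i k) = m then \<gamma>2 k / of_real (\<rho> ^ i k) else 0)"
    and d2: "\<forall>k\<in>{1..N}. \<forall>p<N. (\<Sum>q<N. of_real (gpm N r \<sigma>2 (i k) $$ (p, q)) * d2 k q) = 2 * pi * a (i k)"
    and \<gamma>2: "\<forall>k\<in>{1..N}. (\<Sum>q<N. of_real (r (Suc q) ^ (2 * i k)) * d2 k q) = \<gamma>2 k"
    using S2.exterior_coefficients[OF \<sigma>2 H inj i1] by blast
  note u1 = u1[rule_format] and d1 = d1[rule_format] and \<gamma>1 = \<gamma>1[rule_format]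
    and u2 = u2[rule_format] and d2 = d2[rule_format] and \<gamma>2 = \<gamma>2[rule_format]
  \<comment> \<open>Division by 2 pi turns the unnormalised Fourier data into amplitudes.\<close>
  define \<delta> where "\<delta> k = (\<gamma>1 k - \<gamma>2 k) / (2 * pi)" for k
  have r1: "r 1 > 0"
    using S1.r_pos[of 1] assms(1) by simp
  \<comment> \<open>Both sides have the same coefficients on every circle outside the disk, and
    \<open>fourier_complete\<close> upgrades this to equality of the functions.\<close>
  have exterior: "u1 z - u2 z = (\<Sum>k=1..N. \<delta> k * (1 / cnj z ^ i k))" if z: "norm z > r 1" for z
  proof -
    define \<rho> where "\<rho> = norm z"
    have \<rho>: "\<rho> > r 1" "\<rho> > 0"
      using z r1 by (auto simp: \<rho>_def)
    let ?S = "norm -` {\<rho>} :: complex set"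
    let ?g = "\<lambda>z. \<Sum>k=1..N. \<delta> k * (1 / cnj z ^ i k)"
    have cu: "continuous_on ?S u1" "continuous_on ?S u2"
      using S1.u_cont S2.u_cont continuous_on_subset by blast+
    have ck: "continuous_on ?S (\<lambda>z. \<delta> k * (1 / cnj z ^ i k))" for k
      using \<rho>(2) by (intro continuous_intros) auto
    have cg: "continuous_on ?S ?g"
      by (intro continuous_on_sum ck)
    have "(u1 z - u2 z) - ?g z = 0"
    proof (rule fourier_complete[where g = "\<lambda>z. (u1 z - u2 z) - ?g z" and \<rho> = \<rho>])
      show "continuous_on ?S (\<lambda>z. (u1 z - u2 z) - ?g z)"
        by (intro continuous_on_diff cu cg)
      show "fourier (\<lambda>z. (u1 z - u2 z) - ?g z) m \<rho> = 0" for m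
      proof -
        have "fourier ?g m \<rho> = (\<Sum>k=1..N. fourier (\<lambda>z. \<delta> k * (1 / cnj z ^ i k)) m \<rho>)"
          using ck \<rho>(2) by (intro fourier_sum) auto
        also have "\<dots> = (\<Sum>k=1..N. (if int (i k) = m then \<gamma>1 k / of_real (\<rho> ^ i k) else 0) - (if int (i k) = m then \<gamma>2 k / of_real (\<rho> ^ i k) else 0))"
          unfolding fourier_mult_left fourier_inverse_cnj_power[OF \<rho>(2)]
          by (intro sum.cong) (auto simp: \<delta>_def diff_divide_distrib[symmetric])
        also have "\<dots> = fourier u1 m \<rho> - fourier u2 m \<rho>"
          by (simp add: u1[OF \<rho>(1)] u2[OF \<rho>(1)] sum_subtractf)
        finally have "fourier ?g m \<rho> = fourier u1 m \<rho> - fourier u2 m \<rho>" .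
        moreover have "fourier (\<lambda>z. (u1 z - u2 z) - ?g z) m \<rho> = fourier u1 m \<rho> - fourier u2 m \<rho> - fourier ?g m \<rho>"
          using cu cg \<rho>(2) by (simp add: fourier_diff continuous_on_diff)
        ultimately show ?thesis by simp
      qed
      show "norm z = \<rho>"
        by (simp add: \<rho>_def)
    qed
    then show ?thesis by simp
  qed
  \<comment> \<open>The open set \<Omega> contains the closed disk, and an open set does not meet
    its frontier.\<close>
  have P: "norm z > r 1" if "z \<in> P" for z
  proof (rule ccontr)
    assume "\<not> norm z > r 1"
    then have "z \<in> \<Omega>"
      using S1.disk_subset_layers[of z] assms(18) by auto
    moreover have "z \<in> frontier \<Omega>"
      using that assms(19) openin_imp_subset by blast
    ultimately show False
      using assms(15) by (simp add: frontier_def interior_open)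
  qed
  \<comment> \<open>The substitution w = 1 / cnj z is injective, so the image of \<open>P\<close> is
    an infinite set of zeros of a polynomial in w with distinct exponents.\<close>
  have "\<delta> k = 0" if "k \<in> {1..N}" for k
  proof (rule sum_powers_zero_on_infinite[OF _ inj _ _ that])
    have "inj_on (\<lambda>z. 1 / cnj z) P"
      by (auto simp: inj_on_def)
    then show "infinite ((\<lambda>z. 1 / cnj z) ` P)"
      using assms(20) finite_image_iff by blast
    show "(\<Sum>k=1..N. \<delta> k * w ^ i k) = 0" if w: "w \<in> (\<lambda>z. 1 / cnj z) ` P" for w
    proof -
      obtain z where "z \<in> P" "w = 1 / cnj z"
        using w by blast
      then show ?thesis
        using exterior[OF P] assms(21) by (simp add: power_divide)
    qed
  qed simp
  then have \<gamma>_eq: "\<gamma>1 k = \<gamma>2 k" if "k \<in> {1..N}" for k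
    using that by (simp add: \<delta>_def)
  \<comment> \<open>Off the diagonal the two polarization matrices depend only on the radii and the
    order, so \<open>c\<close> is their entire difference. The library index l stands for interface
    l + 1.\<close>
  define c where "c l = - 2 * (contrast \<sigma>1 (l + 1) - contrast \<sigma>2 (l + 1))" for l
  have T: "(\<Sum>l<N. T_mat N r \<sigma>1 \<sigma>2 i $$ (k, l) * c l) = 0" if k: "k < N" for k
  proof -
    let ?n = "i (Suc k)"
    have k': "Suc k \<in> {1..N}"
      using k by auto
    define h where "h = 2 * pi * a ?n"
    have "h \<noteq> 0"
      using assms(11)[OF k'] by (simp add: h_def)
    \<comment> \<open>The adjugate lemmas are real while \<open>d1\<close> and \<open>d2\<close> are
      complex. Division by \<open>h\<close> turns the right-hand side into 1, and taking real parts
      commutes with real coefficients.\<close>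
    have Re: "Re (s / h) = (\<Sum>q<N. b q * Re (d q / h))" if "(\<Sum>q<N. of_real (b q) * d q) = s" for b :: "nat \<Rightarrow> real" and d s
    proof -
      have "Re (of_real (b q) * d q / h) = b q * Re (d q / h)" for q
      proof -
        have "of_real (b q) * d q / h = b q *\<^sub>R (d q / h)"
          by (simp add: scaleR_conv_of_real)
        then show ?thesis
          by (simp only: scaleR_complex.sel real_scaleR_def)
      qed
      then show ?thesis
        unfolding that[symmetric] sum_divide_distrib Re_sum by (intro sum.cong refl)
    qed
    have "(\<Sum>l<N. (\<Sum>p<N. r (Suc p) ^ (2 * ?n) * adj_mat (gpm N r \<sigma>1 ?n) $$ (p, l)) *
        (\<Sum>j<N. adj_mat (gpm N r \<sigma>2 ?n) $$ (l, j)) * c l) = 0"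
    proof (rule adj_mat_resolvent)
      show "gpm N r \<sigma>1 ?n \<in> carrier_mat N N" "gpm N r \<sigma>2 ?n \<in> carrier_mat N N"
        by (simp_all add: gpm_def)
      show "(\<Sum>q<N. gpm N r \<sigma>1 ?n $$ (p, q) * Re (d1 (Suc k) q / h)) = 1" if "p < N" for p
        using Re[OF d1[OF k' that]] \<open>h \<noteq> 0\<close> by (simp add: h_def)
      show "(\<Sum>q<N. gpm N r \<sigma>2 ?n $$ (p, q) * Re (d2 (Suc k) q / h)) = 1" if "p < N" for p
        using Re[OF d2[OF k' that]] \<open>h \<noteq> 0\<close> by (simp add: h_def)
      show "(\<Sum>p<N. r (Suc p) ^ (2 * ?n) * Re (d1 (Suc k) p / h)) = (\<Sum>p<N. r (Suc p) ^ (2 * ?n) * Re (d2 (Suc k) p / h))"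
        using Re[OF \<gamma>1[OF k']] Re[OF \<gamma>2[OF k']] \<gamma>_eq[OF k'] by simp
      show "gpm N r \<sigma>1 ?n $$ (p, q) - gpm N r \<sigma>2 ?n $$ (p, q) = (if p = q then c p else 0)" if "p < N" "q < N" for p q
        using that by (simp add: gpm_def c_def)
    qed
    then show ?thesis
      using k by (simp add: T_mat_def L_mat_entry R_mat_entry)
  qed
  have contrast: "contrast \<sigma>1 k = contrast \<sigma>2 k" if "k \<in> {1..N}" for k
    using invertible_mat_kernel[OF _ assms(14) T, of "k - 1"] that by (auto simp: T_mat_def c_def)
  \<comment> \<open>A contrast determines \<open>\<sigma> k\<close> only relative to
    \<open>\<sigma> (k - 1)\<close>, so equality is propagated inward from the exterior value
    1.\<close>
  have "k \<le> N \<Longrightarrow> \<sigma>1 k = \<sigma>2 k" for k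
  proof (induction k)
    case 0
    then show ?case
      using assms(4,6) by simp
  next
    case (Suc k)
    then show ?case
      using contrast_inject[of \<sigma>1 "Suc k" \<sigma>2] \<sigma>1[of k] \<sigma>2[of k] contrast[of "Suc k"] S1.\<sigma>_pos[of k] by auto
  qed
  then show ?thesis by simp
qed

end
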